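(* In every plane satisfying the axioms of $\mathcal{M}^{-}$ (the Hilbert plane axioms without SAS), if all the principles of one of the following groups hold: (i) SSS, [RCT], [MS] and [HA]; (ii) SAA, [RCT], [AB], [SA] and [PA]; then the SAS criterion holds.
   Context: The axiom system $\mathcal{M}^{-}$ (a Hilbert plane with the SAS axiom removed) has points, lines, incidence, betweenness $A-B-C$, congruence $\equiv$ of segments and congruence $\equiv$ of angles as primitive notions, with axioms: [I1] Two distinct points are incident with a unique line. [I2] Every line is incident with at least two distinct points. [I3] There are three distinct points not all incident with one line. [O1] If $A-B-C$ then $A,B,C$ are distinct and collinear, and $C-B-A$. [O2] For distinct $B,D$ there are points $A,C,E$ on line $BD$ with $A-B-D$, $B-C-D$, $B-D-E$. [O3] Of three distinct collinear points exactly one is between the other two. [O4] For a line $l$ and points $A,B,C$ not on $l$: (i) if $A,B$ are on the same side of $l$ and $B,C$ are on the same side, then $A,C$ are on the same side; (ii) if $A,B$ are on opposite sides and $B,C$ are on opposite sides, then $A,C$ are on the same side. (Distinct points $X,Y$ not on $l$ are on opposite sides of $l$ if segment $XY$ meets $l$, otherwise on the same side; a point is on the same side as itself.) [C1] If $A\neq B$ and $r$ is a ray from $A'$, there is a unique $B'\ne A'$ on $r$ with $AB\equiv A'B'$. [C2] If $AB\equiv CD$ and $AB\equiv EF$ then $CD\equiv EF$; every segment is congruent to itself. [C3] If $A-B-C$, $A'-B'-C'$, $AB\equiv A'B'$, $BC\equiv B'C'$, then $AC\equiv A'C'$. [C4] Given an angle $\angle BAC$ and a ray $\overrightarrow{A'B'}$,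 there is a unique ray $\overrightarrow{A'C'}$ on a given side of line $A'B'$ with $\angle B'A'C'\equiv\angle BAC$. [C5] If $\angle A\equiv\angle B$ and $\angle A\equiv\angle C$ then $\angle B\equiv\angle C$; every angle is congruent to itself. Segments and angles are unordered ($AB=BA$, $\angle ABC=\angle CBA$); an angle consists of two rays with common origin that are neither equal nor opposite. The interior of $\angle ABC$ is the set of points on the same side of line $BA$ as $C$ and on the same side of line $BC$ as $A$. A ray $\overrightarrow{BG}$ is between $\overrightarrow{BA}$ and $\overrightarrow{BC}$ if $G$ is in the interior of $\angle ABC$. Angles $\angle BAD$ and $\angle CAD$ with $B-A-C$ are supplements of each other. Triangles have noncollinear vertices; $\triangle ABC\equiv\triangle DEF$ means that, under $A\mapsto D$, $B\mapsto E$, $C\mapsto F$, all corresponding sides and all corresponding angles are congruent. Principles (universally quantified): SAS: $AB\equiv DE$, $\angle BAC\equiv\angle EDF$, $AC\equiv DF$ imply $\triangle ABC\equiv\triangle DEF$. SSS: $AB\equiv DE$, $BC\equiv EF$, $AC\equiv DF$ imply $\triangle ABC\equiv\triangle DEF$. SAA: $AC\equiv DF$, $\angle BAC\equiv\angle EDF$, $\angle ABC\equiv\angle DEF$ imply $\triangle ABC\equiv\triangle DEF$. [RCT]: Given $\angle ABC\equiv\angle DEF$, for every ray $\overrightarrow{BG}$ between $\overrightarrow{BA}$ and $\overrightarrow{BC}$ there exists a unique ray $\overrightarrow{EH}$ between $\overrightarrow{ED}$ and $\overrightarrow{EF}$ such that $\angle GBC\equiv\angle HEF$ and $\angle ABG\equiv\angle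 DEH$. [MS]: Every segment $AB$ has a unique midpoint, i.e. a unique $M$ with $A-M-B$ and $AM\equiv MB$. [AB]: Every angle $\angle BAC$ has a bisector, i.e. a ray $\overrightarrow{AD}$ between $\overrightarrow{AB}$ and $\overrightarrow{AC}$ with $\angle BAD\equiv\angle CAD$. [SA]: Supplements of congruent angles are congruent. [PA] (Pons Asinorum): in a triangle $ABC$, $AB\equiv AC$ implies $\angle ABC\equiv\angle ACB$. [HA]: Two right triangles with congruent hypotenuses and congruent acute angles are congruent, where the right angle is understood to be congruent to the supplement sharing with it the side containing the leg opposite the acute angle. Explicitly: let $\triangle APQ$, $\triangle A'P'Q'$ be triangles and $X,X'$ points with $A-Q-X$, $A'-Q'-X'$, $\angle PQA\equiv\angle PQX$, $\angle P'Q'A'\equiv\angle P'Q'X'$; if $AP\equiv A'P'$ and $\angle PAQ\equiv\angle P'A'Q'$, then $\triangle APQ\equiv\triangle A'P'Q'$. *)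

theory Defs
  imports Main
begin

locale plane_signature =
  fixes inc :: "'p \<Rightarrow> 'l \<Rightarrow> bool"
    and btw :: "'p \<Rightarrow> 'p \<Rightarrow> 'p \<Rightarrow> bool"
    and seg_cong :: "'p set \<Rightarrow> 'p set \<Rightarrow> bool"
    and ang_cong :: "'p set set \<Rightarrow> 'p set set \<Rightarrow> bool"
begin

definition line :: "'p \<Rightarrow> 'p \<Rightarrow> 'l" where
  "line A B = (THE l. inc A l \<and> inc B l)"

definition collinear :: "'p \<Rightarrow> 'p \<Rightarrow> 'p \<Rightarrow> bool" where
  "collinear A B C \<longleftrightarrow> (\<exists>l. inc A l \<and> inc B l \<and> inc C l)"

definition segment :: "'p \<Rightarrow> 'p \<Rightarrow> 'p set" where
  "segment A B = {X. X = A \<or> X = B \<or> btw A X B}"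

definition ray :: "'p \<Rightarrow> 'p \<Rightarrow> 'p set" where
  "ray A B = {X. X = A \<or> X = B \<or> btw A X B \<or> btw A B X}"

definition opposite_sides :: "'l \<Rightarrow> 'p \<Rightarrow> 'p \<Rightarrow> bool" where
  "opposite_sides l X Y \<longleftrightarrow>
     X \<noteq> Y \<and> \<not> inc X l \<and> \<not> inc Y l \<and> (\<exists>Z\<in>segment X Y. inc Z l)"

definition same_side :: "'l \<Rightarrow> 'p \<Rightarrow> 'p \<Rightarrow> bool" where
  "same_side l X Y \<longleftrightarrow>
     \<not> inc X l \<and> \<not> inc Y l \<and> (X = Y \<or> \<not> (\<exists>Z\<in>segment X Y. inc Z l))"

definition opposite_rays :: "'p set \<Rightarrow> 'p set \<Rightarrow> bool" where
  "opposite_rays r s \<longleftrightarrow> (\<exists>A B C. btw A B C \<and> r = ray B A \<and> s = ray B C)"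

text \<open>An angle is the unordered pair of its two sides, which are rays; likewise a segment
  is a set of points. Hence congruence does not depend on the order in which the
  points are written. Both congruence relations are only constrained on genuine segments and
  angles, so every axiom and principle carries the corresponding nondegeneracy conditions.\<close>

definition angle :: "'p \<Rightarrow> 'p \<Rightarrow> 'p \<Rightarrow> 'p set set" where
  "angle A B C = {ray B A, ray B C}"

definition proper_angle :: "'p \<Rightarrow> 'p \<Rightarrow> 'p \<Rightarrow> bool" where
  "proper_angle A B C \<longleftrightarrow>
     A \<noteq> B \<and> C \<noteq> B \<and> ray B A \<noteq> ray B C \<and> \<not> opposite_rays (ray B A) (ray B C)"

definition is_angle :: "'p set set \<Rightarrow> bool" where
  "is_angle \<alpha> \<longleftrightarrow> (\<exists>A B C. proper_angle A B C \<and> \<alpha> = angle A B C)"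

definition angle_interior :: "'p \<Rightarrow> 'p \<Rightarrow> 'p \<Rightarrow> 'p set" where
  "angle_interior A B C =
     {X. same_side (line B A) X C \<and> same_side (line B C) X A}"

text \<open>The two supplements of an angle are obtained by extending either of its sides.\<close>

definition supplement :: "'p set set \<Rightarrow> 'p set set \<Rightarrow> bool" where
  "supplement \<alpha> \<beta> \<longleftrightarrow>
     (\<exists>A B C D. btw B A C \<and> proper_angle B A D \<and> proper_angle C A D \<and>
        \<alpha> = angle B A D \<and> \<beta> = angle C A D)"

definition triangle :: "'p \<Rightarrow> 'p \<Rightarrow> 'p \<Rightarrow> bool" where
  "triangle A B C \<longleftrightarrow> \<not> collinear A B C"

definition triangle_cong ::
  "'p \<Rightarrow> 'p \<Rightarrow> 'p \<Rightarrow> 'p \<Rightarrow> 'p \<Rightarrow> 'p \<Rightarrow> bool" where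
  "triangle_cong A B C D E F \<longleftrightarrow>
     triangle A B C \<and> triangle D E F \<and>
     seg_cong (segment A B) (segment D E) \<and>
     seg_cong (segment B C) (segment E F) \<and>
     seg_cong (segment A C) (segment D F) \<and>
     ang_cong (angle B A C) (angle E D F) \<and>
     ang_cong (angle A B C) (angle D E F) \<and>
     ang_cong (angle A C B) (angle D F E)"

definition SAS :: bool where
  "SAS \<longleftrightarrow> (\<forall>A B C D E F.
     triangle A B C \<and> triangle D E F \<and>
     seg_cong (segment A B) (segment D E) \<and>
     ang_cong (angle B A C) (angle E D F) \<and>
     seg_cong (segment A C) (segment D F) \<longrightarrow>
     triangle_cong A B C D E F)"

definition SSS :: bool where
  "SSS \<longleftrightarrow> (\<forall>A B C D E F.
     triangle A B C \<and> triangle D E F \<and>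
     seg_cong (segment A B) (segment D E) \<and>
     seg_cong (segment B C) (segment E F) \<and>
     seg_cong (segment A C) (segment D F) \<longrightarrow>
     triangle_cong A B C D E F)"

definition SAA :: bool where
  "SAA \<longleftrightarrow> (\<forall>A B C D E F.
     triangle A B C \<and> triangle D E F \<and>
     seg_cong (segment A C) (segment D F) \<and>
     ang_cong (angle B A C) (angle E D F) \<and>
     ang_cong (angle A B C) (angle D E F) \<longrightarrow>
     triangle_cong A B C D E F)"

definition RCT :: bool where
  "RCT \<longleftrightarrow> (\<forall>A B C D E F G.
     proper_angle A B C \<and> proper_angle D E F \<and>
     ang_cong (angle A B C) (angle D E F) \<and> G \<in> angle_interior A B C \<longrightarrow>
     (\<exists>!s. \<exists>H. s = ray E H \<and> H \<in> angle_interior D E F \<and>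
        ang_cong (angle G B C) (angle H E F) \<and> ang_cong (angle A B G) (angle D E H)))"

definition MS :: bool where
  "MS \<longleftrightarrow> (\<forall>A B. A \<noteq> B \<longrightarrow>
     (\<exists>!M. btw A M B \<and> seg_cong (segment A M) (segment M B)))"

definition AB :: bool where
  "AB \<longleftrightarrow> (\<forall>A B C. proper_angle B A C \<longrightarrow>
     (\<exists>D. D \<in> angle_interior B A C \<and> ang_cong (angle B A D) (angle C A D)))"

definition SA :: bool where
  "SA \<longleftrightarrow> (\<forall>\<alpha> \<alpha>' \<beta> \<beta>'.
     supplement \<alpha> \<alpha>' \<and> supplement \<beta> \<beta>' \<and> ang_cong \<alpha> \<beta> \<longrightarrow> ang_cong \<alpha>' \<beta>')"

definition PA :: bool where
  "PA \<longleftrightarrow> (\<forall>A B C.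
     triangle A B C \<and> seg_cong (segment A B) (segment A C) \<longrightarrow>
     ang_cong (angle A B C) (angle A C B))"

text \<open>In the absence of \<open>SAS\<close>, an angle may be congruent to one of its supplements but
  not to the other, so \<open>HA\<close> specifies which one: the supplement at \<open>Q\<close> obtained by extending
  the leg \<open>AQ\<close>, i.e. the one sharing with the right angle the side through \<open>P\<close>.\<close>

definition HA :: bool where
  "HA \<longleftrightarrow> (\<forall>A P Q X A' P' Q' X'.
     triangle A P Q \<and> triangle A' P' Q' \<and> btw A Q X \<and> btw A' Q' X' \<and>
     ang_cong (angle P Q A) (angle P Q X) \<and>
     ang_cong (angle P' Q' A') (angle P' Q' X') \<and>
     seg_cong (segment A P) (segment A' P') \<and>
     ang_cong (angle P A Q) (angle P' A' Q') \<longrightarrow>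
     triangle_cong A P Q A' P' Q')"

end

locale M_minus_plane = plane_signature inc btw seg_cong ang_cong
  for inc :: "'p \<Rightarrow> 'l \<Rightarrow> bool"
    and btw :: "'p \<Rightarrow> 'p \<Rightarrow> 'p \<Rightarrow> bool"
    and seg_cong :: "'p set \<Rightarrow> 'p set \<Rightarrow> bool"
    and ang_cong :: "'p set set \<Rightarrow> 'p set set \<Rightarrow> bool" +
  assumes I1: "A \<noteq> B \<Longrightarrow> \<exists>!l. inc A l \<and> inc B l"
    and I2: "\<exists>A B. A \<noteq> B \<and> inc A l \<and> inc B l"
    and I3: "\<exists>A B C. A \<noteq> B \<and> B \<noteq> C \<and> A \<noteq> C \<and> \<not> collinear A B C"
    and O1: "btw A B C \<Longrightarrow>
      A \<noteq> B \<and> B \<noteq> C \<and> A \<noteq> C \<and> collinear A B C \<and> btw C B A"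
    and O2: "B \<noteq> D \<Longrightarrow>
      \<exists>A C E. inc A (line B D) \<and> inc C (line B D) \<and> inc E (line B D) \<and>
        btw A B D \<and> btw B C D \<and> btw B D E"
    and O3: "\<lbrakk>A \<noteq> B; B \<noteq> C; A \<noteq> C; collinear A B C\<rbrakk> \<Longrightarrow>
      (btw B A C \<and> \<not> btw A B C \<and> \<not> btw A C B) \<or>
      (\<not> btw B A C \<and> btw A B C \<and> \<not> btw A C B) \<or>
      (\<not> btw B A C \<and> \<not> btw A B C \<and> btw A C B)"
    and O4_same: "\<lbrakk>\<not> inc A l; \<not> inc B l; \<not> inc C l; same_side l A B; same_side l B C\<rbrakk>
      \<Longrightarrow> same_side l A C"
    and O4_opposite: "\<lbrakk>\<not> inc A l; \<not> inc B l; \<not> inc C l;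
        opposite_sides l A B; opposite_sides l B C\<rbrakk>
      \<Longrightarrow> same_side l A C"
    and C1: "\<lbrakk>A \<noteq> B; D \<noteq> A'\<rbrakk> \<Longrightarrow>
      \<exists>!B'. B' \<noteq> A' \<and> B' \<in> ray A' D \<and> seg_cong (segment A B) (segment A' B')"
    and C2_trans: "\<lbrakk>A \<noteq> B; C \<noteq> D; E \<noteq> F;
        seg_cong (segment A B) (segment C D); seg_cong (segment A B) (segment E F)\<rbrakk>
      \<Longrightarrow> seg_cong (segment C D) (segment E F)"
    and C2_refl: "A \<noteq> B \<Longrightarrow> seg_cong (segment A B) (segment A B)"
    and C3: "\<lbrakk>btw A B C; btw A' B' C';
        seg_cong (segment A B) (segment A' B'); seg_cong (segment B C) (segment B' C')\<rbrakk>
      \<Longrightarrow> seg_cong (segment A C) (segment A' C')"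
    \<comment> \<open>the side of the line \<open>A'B'\<close> is the one containing the point \<open>S\<close>\<close>
    and C4: "\<lbrakk>proper_angle B A C; A' \<noteq> B'; \<not> inc S (line A' B')\<rbrakk> \<Longrightarrow>
      \<exists>!r. \<exists>C'. r = ray A' C' \<and> same_side (line A' B') C' S \<and>
        ang_cong (angle B' A' C') (angle B A C)"
    and C5_trans: "\<lbrakk>is_angle \<alpha>; is_angle \<beta>; is_angle \<gamma>; ang_cong \<alpha> \<beta>; ang_cong \<alpha> \<gamma>\<rbrakk>
      \<Longrightarrow> ang_cong \<beta> \<gamma>"
    and C5_refl: "is_angle \<alpha> \<Longrightarrow> ang_cong \<alpha> \<alpha>"

end

theory Submission
  imports Defs
begin

text \<open>[RCT] makes angles comparable and subtractable, and this already yields that supplements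
  of congruent angles are congruent and that all right angles are congruent. Reflecting a point
  \<open>P\<close> in a line by copying its angle at a point \<open>Z\<close> of the line to the other side gives a kite
  \<open>ZPP'\<close>; either group of principles shows that the diagonal \<open>PP'\<close> meets the line at a right
  angle, so every point has a foot on every line, and either group also gives congruence of right
  triangles from hypotenuse and acute angle. Applied to two feet of one point seen from a third
  point of the line, the latter shows that feet are unique. Hence in a right triangle
  the other two angles are acute. Two right triangles with congruent legs are congruent: copy
  an acute angle and the hypotenuse of one onto a leg of the other; the foot of the copied vertex
  must be the right-angled vertex. Dropping a perpendicular in each triangle reduces SAS to
  that case.\<close>

subsection \<open>Incidence, order and rays\<close>

context M_minus_plane
begin

section \<open>Incidence and collinearity\<close>

lemma line_inc: "A \<noteq> B \<Longrightarrow> inc A (line A B) \<and> inc B (line A B)"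
  unfolding line_def by (rule theI') (rule I1)

lemma line_inc1 [simp]: "A \<noteq> B \<Longrightarrow> inc A (line A B)"
  and line_inc2 [simp]: "A \<noteq> B \<Longrightarrow> inc B (line A B)"
  using line_inc by auto

lemma line_unique: "\<lbrakk>A \<noteq> B; inc A l; inc B l; inc A m; inc B m\<rbrakk> \<Longrightarrow> l = m"
  using I1 by blast

lemma line_eq: "\<lbrakk>A \<noteq> B; inc A l; inc B l\<rbrakk> \<Longrightarrow> line A B = l"
  using line_unique line_inc by blast

lemma line_commute: "line A B = line B A"
  unfolding line_def by (simp add: conj_commute)

lemma exists_other_point: fixes A :: 'p shows "\<exists>B. B \<noteq> A"
proof -
  obtain P Q :: 'p where "P \<noteq> Q" using I3 by blast
  then show ?thesis by (cases "P = A") auto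
qed

lemma collinear_iff: "A \<noteq> B \<Longrightarrow> collinear A B C \<longleftrightarrow> inc C (line A B)"
  unfolding collinear_def using line_inc line_eq by blast

lemma collinear_swap: "collinear A B C \<longleftrightarrow> collinear B A C"
  and collinear_rot: "collinear A B C \<longleftrightarrow> collinear B C A"
  unfolding collinear_def by blast+

lemma collinear_degenerate [simp]: "collinear A A B"
proof -
  obtain C where "C \<noteq> A" using exists_other_point by blast
  then have "\<exists>l. inc A l \<and> inc B l" using I1[of A B] I1[of A C] by (cases "A = B") blast+
  then show ?thesis unfolding collinear_def by blast
qed

lemma collinear_degenerate' [simp]: "collinear A B B" "collinear A B A"
  using collinear_degenerate collinear_rot by blast+

lemma not_collinear_distinct: "\<not> collinear A B C \<Longrightarrow> A \<noteq> B \<and> B \<noteq> C \<and> A \<noteq> C"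
  by auto

lemma exists_off_line: "\<exists>P. \<not> inc P l"
  using I3 unfolding collinear_def by blast

lemma exists_line_avoiding: "A \<noteq> B \<Longrightarrow> \<exists>l. inc A l \<and> \<not> inc B l"
proof -
  assume "A \<noteq> B"
  obtain P where P: "\<not> inc P (line A B)" using exists_off_line by blast
  then have "A \<noteq> P" using \<open>A \<noteq> B\<close> by auto
  then have "inc A (line A P)" "inc P (line A P)" by simp_all
  moreover have "\<not> inc B (line A P)"
  proof
    assume "inc B (line A P)"
    then have "line A B = line A P" using line_eq[OF \<open>A \<noteq> B\<close>] calculation by blast
    then show False using P calculation by simp
  qed
  ultimately show ?thesis by blast
qed

section \<open>Betweenness and the two sides of a line\<close>

lemma btw_distinct: "btw A B C \<Longrightarrow> A \<noteq> B \<and> B \<noteq> C \<and> A \<noteq> C"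
  using O1 by blast

lemma btw_sym: "btw A B C \<Longrightarrow> btw C B A"
  using O1 by blast

lemma btw_line: "btw A B C \<Longrightarrow> \<exists>l. inc A l \<and> inc B l \<and> inc C l"
  using O1 unfolding collinear_def by blast

lemma btw_inc:
  assumes "btw A B C"
  shows "inc A l \<Longrightarrow> inc B l \<Longrightarrow> inc C l"
    and "inc A l \<Longrightarrow> inc C l \<Longrightarrow> inc B l"
    and "inc B l \<Longrightarrow> inc C l \<Longrightarrow> inc A l"
  using btw_line[OF assms] btw_distinct[OF assms] line_unique by metis+

lemma btw_exclusive: "btw A B C \<Longrightarrow> \<not> btw B A C \<and> \<not> btw A C B"
proof -
  assume "btw A B C"
  moreover from this have "A \<noteq> B" "B \<noteq> C" "A \<noteq> C" "collinear A B C" using O1 by blast+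
  ultimately show ?thesis using O3 by blast
qed

lemma btw_cases:
  "\<lbrakk>A \<noteq> B; B \<noteq> C; A \<noteq> C; inc A l; inc B l; inc C l\<rbrakk>
    \<Longrightarrow> btw B A C \<or> btw A B C \<or> btw A C B"
  using O3[of A B C] unfolding collinear_def by blast

lemma exists_beyond: "A \<noteq> B \<Longrightarrow> \<exists>C. btw A B C"
  using O2 by blast

lemma segment_commute: "segment A B = segment B A"
  unfolding segment_def using O1 by blast

lemma same_side_off: "same_side l A B \<Longrightarrow> \<not> inc A l \<and> \<not> inc B l"
  unfolding same_side_def by blast

lemma opposite_sides_off: "opposite_sides l A B \<Longrightarrow> \<not> inc A l \<and> \<not> inc B l"
  unfolding opposite_sides_def by blast

lemma same_side_refl: "\<not> inc A l \<Longrightarrow> same_side l A A"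
  unfolding same_side_def by blast

lemma same_side_sym: "same_side l A B \<Longrightarrow> same_side l B A"
  unfolding same_side_def by (auto simp: segment_commute)

lemma opposite_sides_sym: "opposite_sides l A B \<Longrightarrow> opposite_sides l B A"
  unfolding opposite_sides_def by (auto simp: segment_commute)

lemma same_side_trans: "same_side l A B \<Longrightarrow> same_side l B C \<Longrightarrow> same_side l A C"
  using O4_same same_side_off by blast

lemma opposite_opposite: "opposite_sides l A B \<Longrightarrow> opposite_sides l B C \<Longrightarrow> same_side l A C"
  using O4_opposite opposite_sides_off by blast

lemma side_cases: "\<not> inc A l \<Longrightarrow> \<not> inc B l \<Longrightarrow> same_side l A B \<or> opposite_sides l A B"
  unfolding same_side_def opposite_sides_def by blast

lemma same_not_opposite: "same_side l A B \<Longrightarrow> \<not> opposite_sides l A B"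
  unfolding same_side_def opposite_sides_def by blast

lemma same_opposite: "same_side l A B \<Longrightarrow> opposite_sides l B C \<Longrightarrow> opposite_sides l A C"
  using side_cases same_not_opposite same_side_off opposite_sides_off same_side_trans same_side_sym
  by metis

lemma opposite_btw: "opposite_sides l A B \<Longrightarrow> \<exists>X. btw A X B \<and> inc X l"
  unfolding opposite_sides_def segment_def by auto

lemma btw_opposite: "btw A B C \<Longrightarrow> inc B l \<Longrightarrow> \<not> inc A l \<Longrightarrow> opposite_sides l A C"
  unfolding opposite_sides_def segment_def using btw_distinct btw_inc by blast

text \<open>If \<open>l\<close> separated \<open>B\<close> from \<open>C\<close>, it would cross the
  line \<open>A B C\<close> between them; it meets that line in \<open>A\<close> only, so
  \<open>A\<close> would lie between \<open>B\<close> and \<open>C\<close>.\<close>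

lemma btw_same:
  assumes "btw A B C" "inc A l" "\<not> inc B l"
  shows "same_side l B C"
proof (rule ccontr)
  assume "\<not> same_side l B C"
  moreover have "\<not> inc C l" using assms btw_inc by blast
  ultimately obtain X where X: "btw B X C" "inc X l"
    using assms(3) side_cases opposite_btw by blast
  obtain m where m: "inc A m" "inc B m" "inc C m" using assms btw_line by blast
  then have "inc X m" using X btw_inc by blast
  then have "X = A" using X m assms line_unique by blast
  then show False using X assms(1) btw_exclusive by blast
qed

text \<open>Any further line \<open>l\<close> through the origin cuts a ray out of its carrier as a
  half-line. Facts about rays thus reduce to transitivity of \<open>same_side\<close> for one
  auxiliary line.\<close>

lemma ray_char:
  assumes "A \<noteq> B" "inc A l" "\<not> inc B l"
  shows "X \<in> ray A B \<longleftrightarrow> X = A \<or> inc X (line A B) \<and> same_side l X B"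
proof
  assume "X \<in> ray A B"
  then consider "X = A" | "X = B" | "btw A X B" | "btw A B X" unfolding ray_def by blast
  then show "X = A \<or> inc X (line A B) \<and> same_side l X B"
  proof cases
    case 3
    then have "inc X (line A B)" using assms btw_inc line_inc by blast
    moreover have "\<not> inc X l" using 3 assms btw_inc by blast
    ultimately show ?thesis using 3 btw_same assms by blast
  next
    case 4
    then have "inc X (line A B)" using assms btw_inc line_inc by blast
    then show ?thesis using 4 btw_same assms same_side_sym by blast
  qed (use assms same_side_refl line_inc in auto)
next
  assume "X = A \<or> inc X (line A B) \<and> same_side l X B"
  then show "X \<in> ray A B"
  proof
    assume X: "inc X (line A B) \<and> same_side l X B"
    show ?thesis
    proof (rule ccontr)
      assume *: "X \<notin> ray A B"
      then have "X \<noteq> A" "X \<noteq> B" "\<not> btw A X B" "\<not> btw A B X" unfolding ray_def by blast+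
      then have "btw B A X" using btw_cases[of A B X "line A B"] X assms line_inc by blast
      then have "opposite_sides l B X" using btw_opposite assms by blast
      then show False using X same_not_opposite same_side_sym by blast
    qed
  qed (simp add: ray_def)
qed

lemma ray_inc: "X \<in> ray A B \<Longrightarrow> inc A l \<Longrightarrow> inc B l \<Longrightarrow> inc X l"
  unfolding ray_def using btw_inc by blast

lemma ray_end [simp]: "B \<in> ray A B"
  unfolding ray_def by blast

lemma ray_eqI:
  assumes "C \<in> ray A B" "C \<noteq> A" "A \<noteq> B"
  shows "ray A C = ray A B"
proof -
  obtain l where l: "inc A l" "\<not> inc B l" using assms exists_line_avoiding by blast
  have C: "inc C (line A B)" "same_side l C B" using ray_char assms l by blast+
  have "line A C = line A B" using line_eq assms C line_inc by metis
  moreover have "\<not> inc C l" using C same_side_off by blast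
  ultimately have "X \<in> ray A C \<longleftrightarrow> X \<in> ray A B" for X
    using ray_char[of A C l X] ray_char[of A B l X] l assms C same_side_trans[of l X B C]
      same_side_trans[of l X C B] same_side_sym[of l C B] by auto
  then show ?thesis by blast
qed

lemma ray_eq_mem: "ray A B = ray A C \<Longrightarrow> C \<in> ray A B"
  using ray_end by blast

lemma ray_same_side: "\<lbrakk>X \<in> ray A B; X \<noteq> A; inc A l; \<not> inc B l\<rbrakk> \<Longrightarrow> same_side l X B"
  using ray_char[of A B l X] by (cases "A = B") auto

lemma ray_of_same_side:
  "\<lbrakk>inc A l; same_side l X B; inc A m; inc X m; inc B m\<rbrakk> \<Longrightarrow> X \<in> ray A B"
  using ray_char[of A B l X] same_side_off[of l X B] line_eq[of A B m] by (cases "A = B") auto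

lemma btw_ray: "btw A B C \<Longrightarrow> ray A C = ray A B"
  by (rule ray_eqI) (use btw_distinct in \<open>auto simp: ray_def\<close>)

lemma line_cases:
  assumes "A \<noteq> B" "X \<noteq> A" "inc X (line A B)"
  shows "ray A X = ray A B \<or> btw X A B"
proof (cases "X = B")
  case False
  then have "btw B A X \<or> btw A B X \<or> btw A X B"
    using btw_cases[of A B X "line A B"] assms line_inc by blast
  then show ?thesis using btw_ray btw_sym by metis
qed simp

lemma ray_not_opposite: "ray A X = ray A B \<Longrightarrow> A \<noteq> B \<Longrightarrow> X \<noteq> A \<Longrightarrow> \<not> btw X A B"
  using ray_eq_mem[of A B X] btw_exclusive[of X A B] btw_sym[of A B X] btw_sym[of A X B]
    btw_exclusive[of B A X] btw_sym[of X A B] btw_distinct[of X A B] ray_eq_mem[of A X B]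
  unfolding ray_def by blast

subsection \<open>Angles and their interiors\<close>

text \<open>If the points are collinear, \<open>line_cases\<close> makes the sides equal or
  opposite; conversely, equal or opposite rays share a carrier line. Noncollinearity is the form of
  nondegeneracy used from here on.\<close>

lemma proper_angle_iff: "proper_angle A B C \<longleftrightarrow> \<not> collinear A B C"
proof
  assume p: "proper_angle A B C"
  show "\<not> collinear A B C"
  proof
    assume "collinear A B C"
    then have "inc C (line B A)"
      using p collinear_iff[of B A C] collinear_swap[of A B C] unfolding proper_angle_def by blast
    then have "ray B C = ray B A \<or> btw C B A"
      using line_cases[of B A C] p unfolding proper_angle_def by blast
    then show False using p btw_sym[of C B A] unfolding proper_angle_def opposite_rays_def by auto
  qed
next
  assume n: "\<not> collinear A B C"
  have d: "A \<noteq> B" "C \<noteq> B" using n not_collinear_distinct by blast+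
  have "ray B A \<noteq> ray B C"
  proof
    assume "ray B A = ray B C"
    then have "C \<in> ray B A" by simp
    then have "inc C (line B A)" using ray_inc[of C B A "line B A"] d by simp
    then show False using n d collinear_iff[of B A C] collinear_swap[of A B C] by blast
  qed
  moreover have "\<not> opposite_rays (ray B A) (ray B C)"
  proof
    assume "opposite_rays (ray B A) (ray B C)"
    then obtain A' B' C' where o: "btw A' B' C'" "ray B A = ray B' A'" "ray B C = ray B' C'"
      unfolding opposite_rays_def by blast
    obtain l where l: "inc A' l" "inc B' l" "inc C' l" using o btw_line by blast
    have "A \<in> ray B' A'" "B \<in> ray B' A'" "C \<in> ray B' C'"
      using o ray_end unfolding ray_def by blast+
    then have "inc A l" "inc B l" "inc C l" using l ray_inc by blast+
    then show False using n unfolding collinear_def by blast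
  qed
  ultimately show "proper_angle A B C" using d unfolding proper_angle_def by blast
qed

lemma triangle_offline:
  "\<not> collinear A B C \<Longrightarrow> \<not> inc C (line A B) \<and> \<not> inc C (line B A) \<and> \<not> inc A (line B C)
    \<and> \<not> inc A (line C B) \<and> \<not> inc B (line A C) \<and> \<not> inc B (line C A)"
  using not_collinear_distinct[of A B C] collinear_iff[of A B C] collinear_iff[of B A C]
    collinear_iff[of B C A] collinear_iff[of C B A] collinear_iff[of A C B] collinear_iff[of C A B]
  unfolding collinear_def by blast

lemma offline_triangle: "A \<noteq> B \<Longrightarrow> \<not> inc C (line A B) \<Longrightarrow> \<not> collinear A B C"
  using collinear_iff by blast

lemma line_ray: "ray A B = ray A C \<Longrightarrow> B \<noteq> A \<Longrightarrow> C \<noteq> A \<Longrightarrow> line A B = line A C"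
  using ray_eq_mem[of A C B] ray_inc[of B A C "line A C"] line_eq[of A B "line A C"] by auto

lemma interior_noncollinear:
  assumes "\<not> collinear A B C" "G \<in> angle_interior A B C"
  shows "\<not> collinear A B G" "\<not> collinear G B C"
proof -
  have "\<not> inc G (line B A)" "\<not> inc G (line B C)"
    using assms(2) same_side_off unfolding angle_interior_def by blast+
  then show "\<not> collinear A B G" "\<not> collinear G B C"
    using not_collinear_distinct[OF assms(1)] line_eq[of B A] line_eq[of B C]
    unfolding collinear_def by blast+
qed

text \<open>Crossbar theorem as a separation statement. Extend \<open>A B\<close> beyond
  \<open>B\<close> to \<open>D\<close>. If \<open>A\<close> and \<open>C\<close> lay on one side of
  \<open>B G\<close>, then \<open>D C\<close> would cross \<open>B G\<close> at some
  \<open>W\<close>. This \<open>W\<close> is on the ray \<open>B G\<close>, hence on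
  \<open>A\<close>'s side of \<open>B C\<close>, but being between \<open>D\<close> and
  \<open>C\<close> also on \<open>D\<close>'s side.\<close>

lemma interior_opposite:
  assumes n: "\<not> collinear A B C" and G: "G \<in> angle_interior A B C"
  shows "opposite_sides (line B G) A C"
proof (rule ccontr)
  assume c: "\<not> opposite_sides (line B G) A C"
  have d: "A \<noteq> B" "C \<noteq> B" using n not_collinear_distinct by blast+
  have ss: "same_side (line B A) G C" "same_side (line B C) G A"
    using G unfolding angle_interior_def by blast+
  have GB: "G \<noteq> B" using ss same_side_off d line_inc by metis
  have off: "\<not> inc A (line B G)" "\<not> inc C (line B G)"
    using triangle_offline interior_noncollinear[OF n G] by blast+
  have s: "same_side (line B G) A C" using c off side_cases by blast
  obtain D where D: "btw A B D" using d exists_beyond by blast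
  have Dl: "inc D (line B A)" "D \<noteq> B" using D btw_inc line_inc d btw_distinct by metis+
  have "opposite_sides (line B G) D C"
    using D off s GB btw_opposite[OF D] line_inc same_opposite[OF same_side_sym[OF s]]
      opposite_sides_sym by metis
  then obtain W where W: "btw D W C" "inc W (line B G)" using opposite_btw by blast
  have nC: "\<not> inc C (line B A)" using n triangle_offline by blast
  have WA: "same_side (line B A) W C"
    using btw_same[OF W(1)] Dl W nC btw_inc by metis
  then have "same_side (line B A) W G" using ss same_side_trans same_side_sym by blast
  then have r: "W \<in> ray B G"
    using ray_of_same_side[of B "line B A" W G "line B G"] d GB W line_inc by metis
  have WB: "W \<noteq> B" using WA same_side_off d line_inc by metis
  have "\<not> inc A (line B C)" using n triangle_offline by blast
  then have oD: "opposite_sides (line B C) A D" using D btw_opposite line_inc d by metis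
  have "same_side (line B C) W D"
  proof -
    have "\<not> inc D (line B C)" using oD opposite_sides_off by blast
    then have "\<not> inc W (line B C)"
      using btw_inc(3)[OF W(1), of "line B C"] d by auto
    then show ?thesis using btw_same[OF btw_sym[OF W(1)], of "line B C"] d by simp
  qed
  then have "opposite_sides (line B C) W A"
    using same_opposite opposite_sides_sym oD by blast
  moreover have "same_side (line B C) W A"
    using ray_same_side[OF r WB, of "line B C"] same_side_off[OF ss(2)] d
      same_side_trans[OF _ ss(2), of W] by simp
  ultimately show False using same_not_opposite by blast
qed

text \<open>Converse of the crossbar statement: the point \<open>W\<close> where \<open>B G\<close>
  crosses \<open>A C\<close> lies on \<open>C\<close>'s side of \<open>B A\<close>, as
  \<open>G\<close> does, so it is on the ray \<open>B G\<close>, which inherits \<open>A\<close>'s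
  side of \<open>B C\<close> from \<open>W\<close>.\<close>

lemma interiorI:
  assumes n: "\<not> collinear A B C" and s: "same_side (line B A) G C"
    and o: "opposite_sides (line B G) A C"
  shows "G \<in> angle_interior A B C"
proof -
  have d: "A \<noteq> B" "C \<noteq> B" using n not_collinear_distinct by blast+
  have GB: "G \<noteq> B" using s same_side_off d line_inc by metis
  obtain W where W: "btw A W C" "inc W (line B G)" using o opposite_btw by blast
  have off: "\<not> inc C (line B A)" "\<not> inc A (line B C)" using n triangle_offline by blast+
  have "\<not> inc W (line B A)" "\<not> inc W (line B C)"
    using off btw_inc[OF W(1)] d line_inc1 line_inc2 by metis+
  then have W2: "same_side (line B A) W C" "same_side (line B C) W A"
    using btw_same[OF W(1), of "line B A"] btw_same[OF btw_sym[OF W(1)], of "line B C"] d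
    by simp_all
  have "W \<noteq> B" using W2 same_side_off d line_inc by metis
  have "W \<in> ray B G"
    using ray_of_same_side[of B "line B A" W G "line B G"] d GB W
      same_side_trans[OF W2(1) same_side_sym[OF s]] by simp
  then have "ray B W = ray B G" using ray_eqI GB \<open>W \<noteq> B\<close> by blast
  then have "G \<in> ray B W" by simp
  then have "same_side (line B C) G W"
    using ray_same_side[of G B W] \<open>\<not> inc W (line B C)\<close> GB d by simp
  then show ?thesis using W2 s same_side_trans unfolding angle_interior_def by blast
qed

lemma interior_ray:
  assumes "\<not> collinear A B C" "G \<in> angle_interior A B C" "ray B G = ray B H" "H \<noteq> B"
  shows "H \<in> angle_interior A B C"
proof -
  have d: "A \<noteq> B" "C \<noteq> B" using assms not_collinear_distinct by blast+
  have ss: "same_side (line B A) G C" "same_side (line B C) G A"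
    using assms unfolding angle_interior_def by blast+
  have "H \<in> ray B G" using assms ray_end by blast
  then have "same_side (line B A) H G" "same_side (line B C) H G"
    using ray_same_side[of H B G] assms(4) same_side_off[OF ss(1)] same_side_off[OF ss(2)] d
    by simp_all
  then show ?thesis using ss same_side_trans unfolding angle_interior_def by blast
qed

text \<open>Trichotomy for angles erected on one side of \<open>Z P\<close>; this is how angles are
  compared. If the rays differ and \<open>X\<close> is not inside \<open>P Z Y\<close>, the line
  \<open>Z Y\<close> separates \<open>P\<close> from \<open>X\<close>, and \<open>interiorI\<close>
  puts \<open>Y\<close> inside \<open>P Z X\<close>.\<close>

lemma interior_cases:
  assumes "Z \<noteq> P" "same_side (line Z P) X Y"
  shows "ray Z X = ray Z Y \<or> X \<in> angle_interior P Z Y \<or> Y \<in> angle_interior P Z X"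
proof -
  have off: "\<not> inc X (line Z P)" "\<not> inc Y (line Z P)" using assms same_side_off by blast+
  have d: "X \<noteq> Z" "Y \<noteq> Z" using off assms line_inc by metis+
  have n: "\<not> collinear P Z Y" "\<not> collinear P Z X"
    using off assms collinear_iff[of Z P] collinear_swap by blast+
  show ?thesis
  proof (cases "inc X (line Z Y)")
    case True
    then have "X \<in> ray Z Y" using ray_of_same_side[of Z "line Z P" X Y "line Z Y"] assms d
      by simp
    then show ?thesis using ray_eqI d by metis
  next
    case False
    have P: "\<not> inc P (line Z Y)" using n triangle_offline by blast
    have P': "\<not> inc P (line Z X)" "\<not> inc Y (line Z X)"
      using n(2) triangle_offline False line_eq[of Z Y "line Z X"] d by force+
    show ?thesis
    proof (cases "same_side (line Z Y) X P")
      case True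
      then show ?thesis using assms unfolding angle_interior_def by blast
    next
      case False2: False
      then have o: "opposite_sides (line Z Y) P X" using False P side_cases opposite_sides_sym by blast
      then have "Y \<in> angle_interior P Z X"
        using interiorI[of P Z X Y] n assms same_side_sym by blast
      then show ?thesis by blast
    qed
  qed
qed

subsection \<open>Congruence\<close>

text \<open>Unlike the primitive relations, \<open>segc\<close> and \<open>angc\<close> entail nondegeneracy, so that they are
  symmetric and transitive without side conditions.\<close>

definition segc :: "'p \<Rightarrow> 'p \<Rightarrow> 'p \<Rightarrow> 'p \<Rightarrow> bool" where
  "segc A B C D \<longleftrightarrow> A \<noteq> B \<and> C \<noteq> D \<and> seg_cong (segment A B) (segment C D)"

definition angc :: "'p \<Rightarrow> 'p \<Rightarrow> 'p \<Rightarrow> 'p \<Rightarrow> 'p \<Rightarrow> 'p \<Rightarrow> bool" where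
  "angc A B C D E F \<longleftrightarrow> \<not> collinear A B C \<and> \<not> collinear D E F \<and>
     ang_cong (angle A B C) (angle D E F)"

lemma segc_refl: "A \<noteq> B \<Longrightarrow> segc A B A B"
  unfolding segc_def using C2_refl by blast

lemma segc_sym: "segc A B C D \<Longrightarrow> segc C D A B"
  unfolding segc_def using C2_trans[of A B C D A B] C2_refl[of A B] by blast

lemma segc_trans: "segc A B C D \<Longrightarrow> segc C D E F \<Longrightarrow> segc A B E F"
  using segc_sym[of A B C D] unfolding segc_def using C2_trans[of C D A B E F] by blast

lemma segc_commute:
  "segc A B C D \<longleftrightarrow> segc B A C D"
  "segc A B C D \<longleftrightarrow> segc A B D C"
  unfolding segc_def by (auto simp: segment_commute)

lemma segc_swap: "segc A B C D \<Longrightarrow> segc B A D C"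
  using segc_commute[of A B C D] segc_commute[of B A C D] by blast

lemma is_angle_angle: "\<not> collinear A B C \<Longrightarrow> is_angle (angle A B C)"
  unfolding is_angle_def proper_angle_iff by blast

lemma angc_refl: "\<not> collinear A B C \<Longrightarrow> angc A B C A B C"
  unfolding angc_def using C5_refl[OF is_angle_angle[of A B C]] by blast

lemma angc_noncollinear: "angc A B C D E F \<Longrightarrow> \<not> collinear A B C \<and> \<not> collinear D E F"
  unfolding angc_def by blast

lemma angc_sym: "angc A B C D E F \<Longrightarrow> angc D E F A B C"
proof -
  assume a: "angc A B C D E F"
  then have "is_angle (angle A B C)" "is_angle (angle D E F)"
    using is_angle_angle unfolding angc_def by blast+
  then show ?thesis using a C5_refl[of "angle A B C"] C5_trans[of "angle A B C" "angle D E F" "angle A B C"]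
    unfolding angc_def by blast
qed

lemma angc_trans:
  assumes "angc A B C D E F" "angc D E F G H I"
  shows "angc A B C G H I"
proof -
  have "is_angle (angle A B C)" "is_angle (angle D E F)" "is_angle (angle G H I)"
    using assms is_angle_angle unfolding angc_def by blast+
  moreover have "ang_cong (angle D E F) (angle A B C)"
    using angc_sym[OF assms(1)] unfolding angc_def by blast
  ultimately show ?thesis using assms C5_trans[of "angle D E F" "angle A B C" "angle G H I"]
    unfolding angc_def by blast
qed

lemma angle_commute: "angle A B C = angle C B A"
  unfolding angle_def by blast

lemma collinear_reverse: "collinear A B C \<longleftrightarrow> collinear C B A"
  unfolding collinear_def by blast

lemma angc_left: "angc A B C D E F \<Longrightarrow> angc C B A D E F"
  and angc_right: "angc A B C D E F \<Longrightarrow> angc A B C F E D"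
  unfolding angc_def using angle_commute[of A B C] angle_commute[of D E F]
    collinear_reverse[of A B C] collinear_reverse[of D E F] by auto

lemma angc_swap: "angc A B C D E F \<Longrightarrow> angc C B A F E D"
  using angc_left[OF angc_right] .

lemma noncollinear_rays:
  "\<lbrakk>\<not> collinear A B C; ray B A' = ray B A; ray B C' = ray B C; A' \<noteq> B; C' \<noteq> B\<rbrakk>
    \<Longrightarrow> \<not> collinear A' B C'"
  unfolding proper_angle_iff[symmetric] proper_angle_def by simp

lemma angc_rays:
  "\<lbrakk>angc A B C D E F; ray B A' = ray B A; ray B C' = ray B C; A' \<noteq> B; C' \<noteq> B\<rbrakk>
    \<Longrightarrow> angc A' B C' D E F"
  using noncollinear_rays[of A B C A' C'] unfolding angc_def angle_def by simp

lemma angle_rays_refl: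
  "\<lbrakk>\<not> collinear A B C; ray B A' = ray B A; ray B C' = ray B C; A' \<noteq> B; C' \<noteq> B\<rbrakk>
    \<Longrightarrow> angc A B C A' B C'"
  using angc_sym[OF angc_rays[OF angc_refl]] by blast

section \<open>Copying angles, segments and triangles\<close>

lemma angle_copy:
  assumes "\<not> collinear P Q R" "A \<noteq> B" "\<not> inc S (line A B)"
  shows "\<exists>C. same_side (line A B) C S \<and> angc B A C P Q R"
proof -
  obtain C where C: "same_side (line A B) C S" "ang_cong (angle B A C) (angle P Q R)"
    using C4[of P Q R A B S] assms proper_angle_iff by blast
  then have "\<not> collinear A B C" using same_side_off offline_triangle assms by blast
  then have "\<not> collinear B A C" using collinear_swap by blast
  then show ?thesis using C assms unfolding angc_def by blast
qed

lemma angle_copy_unique: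
  assumes "angc B A C B A D" "same_side (line A B) C D"
  shows "ray A C = ray A D"
proof -
  have n: "\<not> collinear B A D" using assms angc_def by blast
  then have d: "A \<noteq> B" "\<not> inc D (line A B)" using triangle_offline not_collinear_distinct by blast+
  have "ang_cong (angle B A C) (angle B A D)" "ang_cong (angle B A D) (angle B A D)"
    using assms angc_refl[OF n] angc_def by blast+
  moreover have "same_side (line A B) D D" using d same_side_refl by blast
  moreover have "\<exists>!r. \<exists>C'. r = ray A C' \<and> same_side (line A B) C' D \<and>
      ang_cong (angle B A C') (angle B A D)"
    using C4[of B A D A B D] n d unfolding proper_angle_iff by simp
  ultimately show ?thesis using assms(2) by blast
qed

lemma segment_copy:
  assumes "A \<noteq> B" "D \<noteq> E"
  shows "\<exists>X. X \<noteq> D \<and> ray D X = ray D E \<and> segc A B D X"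
proof -
  obtain X where "X \<noteq> D" "X \<in> ray D E" "seg_cong (segment A B) (segment D X)"
    using C1[of A B E D] assms by auto
  then show ?thesis using assms ray_eqI[of X D E] unfolding segc_def by auto
qed

lemma segment_copy_unique:
  assumes "segc D X D Y" "ray D X = ray D Y"
  shows "X = Y"
proof -
  have "X \<in> ray D Y" "Y \<in> ray D Y" "X \<noteq> D" "Y \<noteq> D" "D \<noteq> X"
    using assms ray_end unfolding segc_def by blast+
  moreover have "seg_cong (segment D X) (segment D X)" "seg_cong (segment D X) (segment D Y)"
    using assms(1) C2_refl unfolding segc_def by blast+
  ultimately show ?thesis using C1[of D X Y D] by blast
qed

section \<open>Adding and subtracting segments\<close>

lemma segment_add:
  "\<lbrakk>btw A B C; btw A' B' C'; segc A B A' B'; segc B C B' C'\<rbrakk> \<Longrightarrow> segc A C A' C'"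
  unfolding segc_def using C3 btw_distinct by blast

text \<open>Lay off \<open>B C\<close> beyond \<open>B'\<close> to get \<open>X\<close>. By C3
  \<open>A' X\<close> is congruent to \<open>A C\<close>, hence to \<open>A' C'\<close>, and
  uniqueness in C1 forces \<open>X = C'\<close>.\<close>

lemma segment_subtract:
  assumes b: "btw A B C" and c: "segc A B A' B'" "segc A C A' C'" and r: "ray A' B' = ray A' C'"
  shows "btw A' B' C' \<and> segc B C B' C'"
proof -
  have d: "A' \<noteq> B'" "B \<noteq> C" using b c btw_distinct unfolding segc_def by blast+
  obtain D where D: "btw A' B' D" using d exists_beyond by blast
  then obtain X where X: "X \<noteq> B'" "ray B' X = ray B' D" "segc B C B' X"
    using segment_copy[of B C B' D] d btw_distinct by blast
  \<comment> \<open>A line through \<open>B'\<close> missing \<open>A'\<close> separates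
    \<open>A'\<close> from \<open>X\<close>; its crossing point with \<open>A' X\<close> can only be
    \<open>B'\<close>, which gives \<open>btw A' B' X\<close>.\<close>
  have "opposite_sides l A' X" if l: "inc B' l" "\<not> inc A' l" for l
  proof -
    have o: "opposite_sides l A' D" using btw_opposite[OF D] l by blast
    then have "same_side l X D"
      using ray_same_side[of X B' D l] X l opposite_sides_off ray_eq_mem by blast
    then show ?thesis using o same_opposite opposite_sides_sym by blast
  qed
  moreover obtain l where l: "inc B' l" "\<not> inc A' l" using d exists_line_avoiding by metis
  ultimately obtain W where W: "btw A' W X" "inc W l" using opposite_btw by blast
  obtain m where m: "inc A' m" "inc B' m" "inc D m" using D btw_line by blast
  have "X \<in> ray B' D" using X ray_end by blast
  then have "inc X m" using m ray_inc by blast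
  then have "W = B'" using W l m btw_inc line_unique by blast
  then have bX: "btw A' B' X" using W by simp
  then have "segc A C A' X" using segment_add b c X by blast
  then have "segc A' X A' C'" using c segc_sym segc_trans by blast
  moreover have "ray A' X = ray A' C'" using btw_ray[OF bX] r by simp
  ultimately have "X = C'" using segment_copy_unique by blast
  then show ?thesis using bX X by blast
qed

lemma triangle_copy:
  assumes "\<not> collinear P Q R" "A \<noteq> B" "\<not> inc S (line A B)" "U \<noteq> V"
  shows "\<exists>C. same_side (line A B) C S \<and> angc B A C P Q R \<and> segc A C U V"
proof -
  obtain D where D: "same_side (line A B) D S" "angc B A D P Q R"
    using angle_copy assms by blast
  have DA: "D \<noteq> A" using angc_noncollinear[OF D(2)] by auto
  then obtain C where C: "C \<noteq> A" "ray A C = ray A D" "segc U V A C"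
    using segment_copy assms by metis
  have "C \<in> ray A D" using C ray_end by blast
  then have "same_side (line A B) C D"
    using ray_same_side[of C A D "line A B"] C D same_side_off assms by simp
  moreover have "angc B A C P Q R" using angc_rays[OF D(2) refl C(2)] C assms by auto
  ultimately show ?thesis using C D same_side_trans segc_sym by blast
qed

lemma btw_noncollinear: "btw B A C \<Longrightarrow> \<not> collinear B A D \<Longrightarrow> \<not> collinear C A D"
  unfolding collinear_def using btw_inc by blast

text \<open>Both \<open>X\<close> and \<open>Y\<close> lie opposite to \<open>A\<close> across an
  auxiliary line through \<open>Q\<close>, hence on one side of it.\<close>

lemma btw_ray_unique:
  assumes "btw A Q X" "btw A Q Y"
  shows "ray Q X = ray Q Y"
proof -
  have d: "A \<noteq> Q" "Q \<noteq> X" "Q \<noteq> Y" using assms btw_distinct by blast+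
  then obtain l where l: "inc Q l" "\<not> inc A l" using exists_line_avoiding by metis
  then have "same_side l X Y"
    using btw_opposite[OF assms(1)] btw_opposite[OF assms(2)] opposite_sides_sym opposite_opposite
    by blast
  moreover obtain m where "inc A m" "inc Q m" "inc X m" using assms btw_line by blast
  moreover from this have "inc Y m" using assms btw_inc by blast
  ultimately have "X \<in> ray Q Y" using ray_of_same_side l by blast
  then show ?thesis using ray_eqI d by metis
qed

end

section \<open>Consequences of [RCT]: comparison of supplements\<close>

locale RCT_plane = M_minus_plane inc btw seg_cong ang_cong
  for inc :: "'p \<Rightarrow> 'l \<Rightarrow> bool"
    and btw :: "'p \<Rightarrow> 'p \<Rightarrow> 'p \<Rightarrow> bool"
    and seg_cong :: "'p set \<Rightarrow> 'p set \<Rightarrow> bool"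
    and ang_cong :: "'p set set \<Rightarrow> 'p set set \<Rightarrow> bool" +
  assumes rct: RCT
begin

lemma ray_copy:
  assumes "angc A B C D E F" "G \<in> angle_interior A B C"
  shows "\<exists>H. H \<in> angle_interior D E F \<and> angc G B C H E F \<and> angc A B G D E H"
proof -
  have n: "\<not> collinear A B C" "\<not> collinear D E F" and c: "ang_cong (angle A B C) (angle D E F)"
    using assms unfolding angc_def by blast+
  then have "\<exists>!s. \<exists>H. s = ray E H \<and> H \<in> angle_interior D E F \<and>
      ang_cong (angle G B C) (angle H E F) \<and> ang_cong (angle A B G) (angle D E H)"
    using rct assms(2) unfolding RCT_def proper_angle_iff by simp
  then obtain H where H: "H \<in> angle_interior D E F" "ang_cong (angle G B C) (angle H E F)"
      "ang_cong (angle A B G) (angle D E H)"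
    by blast
  then show ?thesis
    using interior_noncollinear[OF n(1) assms(2)] interior_noncollinear[OF n(2) H(1)]
    unfolding angc_def by blast
qed

text \<open>If the supplement of one of two congruent angles were smaller than that of the other, then
  extending both angles by the smaller supplement would give congruent angles, one of
  them straight.\<close>

lemma supplement_not_less:
  assumes b: "btw B A C" "btw B' A' C'" and a: "angc B A D B' A' D'" "angc D A C D' A' E"
    and E: "E \<in> angle_interior D' A' C'"
  shows False
proof -
  have n: "\<not> collinear B A D" "\<not> collinear B' A' D'" using a angc_noncollinear by blast+
  then have n': "\<not> collinear D A C" "\<not> collinear D' A' C'"
    using btw_noncollinear[OF b(1)] btw_noncollinear[OF b(2)] collinear_reverse by blast+
  have d: "A \<noteq> B" "A' \<noteq> B'" "A \<noteq> C" "A' \<noteq> C'" using b btw_distinct by blast+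
  have ss: "same_side (line A' D') E C'" "same_side (line A' C') E D'"
    using E unfolding angle_interior_def by blast+
  have l: "line A B = line A C" "line A' B' = line A' C'"
    using d btw_inc(1)[OF b(1), of "line A B"] btw_inc(1)[OF b(2), of "line A' B'"]
      line_eq[of A C "line A B"] line_eq[of A' C' "line A' B'"] by simp_all
  \<comment> \<open>The line \<open>A' E\<close> separates \<open>D'\<close> from \<open>C'\<close>
    by the crossbar statement, and \<open>B'\<close> from \<open>C'\<close> because
    \<open>A'\<close> is between them. So \<open>D'\<close> and \<open>B'\<close> share a side, and
    \<open>D'\<close> is inside \<open>B' A' E\<close>.\<close>
  have o: "opposite_sides (line A' E) D' C'" using interior_opposite[OF n'(2) E] .
  have EA: "E \<noteq> A'" using same_side_off[OF ss(2)] d by auto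
  then have "\<not> inc B' (line A' E)"
    using o opposite_sides_off btw_inc(1)[OF b(2), of "line A' E"] by auto
  then have "opposite_sides (line A' E) B' C'" using btw_opposite[OF b(2)] EA by simp
  then have "same_side (line A' E) D' B'" using o opposite_sides_sym opposite_opposite by blast
  then have D': "D' \<in> angle_interior B' A' E"
    using ss l same_side_sym unfolding angle_interior_def by auto
  have nE: "\<not> collinear B' A' E"
    using same_side_off[OF ss(2)] l(2) collinear_iff[of A' B' E] d collinear_swap[of A' B' E]
    by simp
  have "\<not> inc D (line A B)" using n triangle_offline by blast
  \<comment> \<open>\<open>F\<close> carries the whole angle \<open>B' A' E\<close> over to
    \<open>A\<close>. [RCT] takes its inner ray \<open>A' D'\<close> to \<open>A H\<close>, which
    uniqueness of angle copying identifies with \<open>A D\<close>; then \<open>D A F\<close> and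
    \<open>D A C\<close> are both copies of \<open>D' A' E\<close>, which forces \<open>F\<close>
    onto the line \<open>A B\<close>.\<close>
  then obtain F where F: "same_side (line A B) F D" "angc B A F B' A' E"
    using angle_copy[OF nE d(1)] by blast
  obtain H where H: "H \<in> angle_interior B A F" "angc D' A' E H A F" "angc B' A' D' B A H"
    using ray_copy[OF angc_sym[OF F(2)] D'] by blast
  have "same_side (line A B) H F" using H(1) unfolding angle_interior_def by blast
  then have "same_side (line A B) H D" using F same_side_trans by blast
  moreover have "angc B A H B A D" using angc_sym[OF angc_trans[OF a(1) H(3)]] .
  ultimately have r: "ray A H = ray A D" using angle_copy_unique by blast
  have nF: "\<not> collinear B A F" using F angc_noncollinear by blast
  have HA: "H \<noteq> A" using interior_noncollinear[OF nF H(1)] by auto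
  have DA: "D \<noteq> A" using n by auto
  have "opposite_sides (line A D) B F"
    using interior_opposite[OF nF H(1)] line_ray[OF r HA DA] by simp
  moreover have "opposite_sides (line A D) B C"
    using btw_opposite[OF b(1), of "line A D"] n DA triangle_offline by auto
  ultimately have s: "same_side (line A D) F C" using opposite_sides_sym opposite_opposite by blast
  have "angc D A C H A F" using angc_trans[OF a(2) H(2)] .
  then have "angc H A F D A C" using angc_sym by blast
  then have "angc D A F D A C"
    using angc_rays[OF _ r[symmetric] refl, of F] DA
      not_collinear_distinct[OF nF] by blast
  then have "ray A F = ray A C" using s angle_copy_unique by blast
  then have "F \<in> ray A C" using ray_end by blast
  then have "inc F (line A B)" using ray_inc[of F A C "line A C"] d l by simp
  then show False using F same_side_off by blast
qed

text \<open>Copy the supplement \<open>D A C\<close> onto \<open>A' D'\<close> on the side of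
  \<open>C'\<close> and compare it with \<open>D' A' C'\<close>: \<open>supplement_not_less\<close>
  excludes both strict cases.\<close>

lemma supplements_congruent:
  assumes b: "btw B A C" "btw B' A' C'" and a: "angc B A D B' A' D'"
  shows "angc C A D C' A' D'"
proof -
  have n: "\<not> collinear B A D" "\<not> collinear B' A' D'" using a angc_noncollinear by blast+
  then have n': "\<not> collinear D A C" "\<not> collinear D' A' C'"
    using btw_noncollinear[OF b(1)] btw_noncollinear[OF b(2)] collinear_reverse by blast+
  have d: "A' \<noteq> D'" "A' \<noteq> C'" using n' by auto
  have "\<not> inc C' (line A' D')" using n' triangle_offline by blast
  then obtain E where E: "same_side (line A' D') E C'" "angc D' A' E D A C"
    using angle_copy[OF n'(1) d(1)] by blast
  consider "ray A' E = ray A' C'" | "E \<in> angle_interior D' A' C'" | "C' \<in> angle_interior D' A' E"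
    using interior_cases[OF d(1) E(1)] by blast
  then show ?thesis
  proof cases
    case 1
    then have "angc D' A' C' D A C" using angc_rays[OF E(2) refl, of C'] d by auto
    then show ?thesis using angc_swap angc_sym by blast
  next
    case 2
    then show ?thesis using supplement_not_less[OF b a angc_sym[OF E(2)]] by blast
  next
    case 3
    \<comment> \<open>Here \<open>D' A' C'\<close> is the smaller supplement; carrying the ray
      \<open>A' C'\<close> into \<open>D A C\<close> reverses the roles of the two figures.\<close>
    then obtain H where "H \<in> angle_interior D A C" "angc D' A' C' D A H"
      using ray_copy[OF E(2)] by blast
    then show ?thesis using supplement_not_less[OF b(2,1) angc_sym[OF a]] by blast
  qed
qed

subsection \<open>Right angles\<close>

text \<open>The supplement is formed along the leg \<open>Q A\<close>, which is the convention of
  \<open>HA\<close>. The choice of \<open>X\<close> is immaterial by \<open>right_btw\<close>, and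
  the two sides may be exchanged by \<open>right_sym\<close>.\<close>

definition right_angle :: "'p \<Rightarrow> 'p \<Rightarrow> 'p \<Rightarrow> bool" where
  "right_angle P Q A \<longleftrightarrow> (\<exists>X. btw A Q X \<and> angc P Q A P Q X)"

lemma right_noncollinear: "right_angle P Q A \<Longrightarrow> \<not> collinear P Q A"
  unfolding right_angle_def angc_def by blast

lemma right_btw:
  assumes "right_angle P Q A" "btw A Q X"
  shows "angc P Q A P Q X"
proof -
  obtain Y where Y: "btw A Q Y" "angc P Q A P Q Y" using assms right_angle_def by blast
  have "ray Q X = ray Q Y" using btw_ray_unique assms Y by blast
  then have "angc P Q X P Q A"
    using angc_rays[OF angc_sym[OF Y(2)] refl, of X] btw_distinct[OF assms(2)]
      not_collinear_distinct[of P Q A] angc_noncollinear[OF Y(2)] by blast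
  then show ?thesis using angc_sym by blast
qed

lemma right_cong:
  assumes "right_angle P Q A" "angc P Q A P' Q' A'"
  shows "right_angle P' Q' A'"
proof -
  obtain X where X: "btw A Q X" "angc P Q A P Q X" using assms right_angle_def by blast
  have "A' \<noteq> Q'" using angc_noncollinear[OF assms(2)] by auto
  then obtain X' where X': "btw A' Q' X'" using exists_beyond by blast
  have "angc X Q P X' Q' P'" using supplements_congruent[OF X(1) X' angc_swap[OF assms(2)]] .
  then have "angc P Q A P' Q' X'" using angc_trans[OF X(2)] angc_swap by blast
  then have "angc P' Q' A' P' Q' X'" using angc_trans[OF angc_sym[OF assms(2)]] by blast
  then show ?thesis using X' right_angle_def by blast
qed

text \<open>The two supplements of \<open>P Q A\<close>, one along each side, are congruent because
  they are supplements of the same angle.\<close>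

lemma right_sym:
  assumes "right_angle P Q A"
  shows "right_angle A Q P"
proof -
  obtain X where X: "btw A Q X" "angc P Q A P Q X" using assms right_angle_def by blast
  have n: "\<not> collinear P Q A" using assms right_noncollinear by blast
  then obtain Y where Y: "btw P Q Y" using exists_beyond[of P Q] not_collinear_distinct by blast
  have "angc Y Q A X Q P"
    using supplements_congruent[OF Y X(1) angc_right[OF angc_refl[OF n]]] .
  then have "angc A Q P A Q Y"
    using angc_trans[OF angc_left[OF X(2)] angc_sym[OF angc_right]] angc_right by blast
  then show ?thesis using Y right_angle_def by blast
qed

lemma right_opposite: "right_angle P Q A \<Longrightarrow> btw A Q X \<Longrightarrow> right_angle P Q X"
  using right_cong right_btw by blast

lemma right_line:
  assumes "right_angle P Q A" "inc B (line Q A)" "B \<noteq> Q"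
  shows "right_angle P Q B"
proof -
  have n: "\<not> collinear P Q A" and d: "Q \<noteq> A" "P \<noteq> Q"
    using assms right_noncollinear not_collinear_distinct by blast+
  consider "ray Q B = ray Q A" | "btw B Q A" using line_cases[of Q A B] assms d by blast
  then show ?thesis
  proof cases
    case 1
    then have "angc P Q A P Q B" using angle_rays_refl[OF n refl, of B] assms d by blast
    then show ?thesis using right_cong assms by blast
  next
    case 2
    then show ?thesis using right_opposite assms btw_sym by blast
  qed
qed

text \<open>[RCT] carries the ray \<open>Q E\<close> from \<open>A Q P\<close> to a ray
  \<open>Q H\<close> in the adjacent right angle \<open>X Q P\<close>. As \<open>E Q A\<close> is
  right too, \<open>X Q H\<close> and \<open>X Q E\<close> are congruent, so the two rays coincide;
  yet \<open>H\<close> and \<open>E\<close> lie on different sides of \<open>Q P\<close>.\<close>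

lemma right_not_less:
  assumes r: "right_angle P Q A" "right_angle E Q A" and E: "E \<in> angle_interior A Q P"
  shows False
proof -
  obtain X where X: "btw A Q X" "angc P Q A P Q X" using r right_angle_def by blast
  have n: "\<not> collinear P Q A" "\<not> collinear P Q X" using X angc_noncollinear by blast+
  have d: "Q \<noteq> A" "Q \<noteq> X" "Q \<noteq> P" using n by auto
  have l: "line Q X = line Q A"
    using d btw_inc(1)[OF X(1), of "line Q A"] line_eq[of Q X "line Q A"] by simp
  obtain H where H: "H \<in> angle_interior X Q P" "angc A Q E X Q H"
    using ray_copy[OF angc_swap[OF X(2)] E] by blast
  have e: "angc E Q A E Q X" using right_btw[OF r(2) X(1)] .
  then have "angc X Q H X Q E"
    using angc_trans[OF angc_sym[OF H(2)]] angc_swap by blast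
  moreover have "same_side (line Q X) H E"
  proof -
    have "same_side (line Q X) H P" using H unfolding angle_interior_def by blast
    moreover have "same_side (line Q X) E P" using E l unfolding angle_interior_def by simp
    ultimately show ?thesis using same_side_trans[OF _ same_side_sym] by blast
  qed
  ultimately have r: "ray Q H = ray Q E" using angle_copy_unique by blast
  have s: "same_side (line Q P) H X" "same_side (line Q P) E A"
    using H E unfolding angle_interior_def by blast+
  have "H \<in> ray Q E" using r ray_end by blast
  moreover have "H \<noteq> Q" using same_side_off[OF s(1)] d by auto
  ultimately have "same_side (line Q P) H E"
    using ray_same_side[of H Q E "line Q P"] same_side_off[OF s(2)] d by simp
  then have "same_side (line Q P) A X" using s same_side_trans same_side_sym by blast
  moreover have "opposite_sides (line Q P) A X"
    using btw_opposite[OF X(1), of "line Q P"] d n triangle_offline by simp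
  ultimately show False using same_not_opposite by blast
qed

text \<open>Copy the second angle onto \<open>Q A\<close> on the side of \<open>P\<close>. The copy
  is again right, so by \<open>right_not_less\<close> neither angle lies strictly inside the
  other.\<close>

lemma right_angles_congruent:
  assumes r: "right_angle P Q A" "right_angle P' Q' A'"
  shows "angc P Q A P' Q' A'"
proof -
  have n: "\<not> collinear P Q A" "\<not> collinear P' Q' A'" using r right_noncollinear by blast+
  have d: "Q \<noteq> A" "P \<noteq> Q" using n by auto
  have "\<not> inc P (line Q A)" using n triangle_offline by blast
  then obtain E where E: "same_side (line Q A) E P" "angc A Q E P' Q' A'"
    using angle_copy[OF n(2) d(1)] by blast
  have rE: "right_angle E Q A" using right_cong[OF r(2) angc_sym[OF angc_left[OF E(2)]]] .
  consider "ray Q E = ray Q P" | "E \<in> angle_interior A Q P" | "P \<in> angle_interior A Q E"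
    using interior_cases[OF d(1) E(1)] by blast
  then show ?thesis
  proof cases
    case 1
    then have "angc A Q P P' Q' A'" using angc_rays[OF E(2) refl, of P] d by auto
    then show ?thesis using angc_left by blast
  qed (use right_not_less r rE in blast)+
qed

text \<open>On one side of \<open>Q A\<close> two perpendiculars at \<open>Q\<close> agree by
  uniqueness of angle copying; if \<open>P\<close> and \<open>R\<close> are on opposite sides,
  \<open>P\<close> is first extended through \<open>Q\<close> to \<open>S\<close>.\<close>

lemma perpendicular_unique:
  assumes r: "right_angle P Q A" "right_angle R Q A"
  shows "inc R (line Q P)"
proof -
  have n: "\<not> collinear P Q A" "\<not> collinear R Q A" using r right_noncollinear by blast+
  have d: "Q \<noteq> A" "P \<noteq> Q" using n by auto
  have same: "inc R (line Q S)" if S: "right_angle S Q A" "same_side (line Q A) R S" for S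
  proof -
    have "angc A Q R A Q S" using right_angles_congruent[OF r(2) S(1)] angc_swap by blast
    then have "ray Q R = ray Q S" using S angle_copy_unique by blast
    then have "R \<in> ray Q S" using ray_end by blast
    moreover have "Q \<noteq> S" using right_noncollinear[OF S(1)] by auto
    ultimately show ?thesis using ray_inc by simp
  qed
  show ?thesis
  proof (cases "same_side (line Q A) R P")
    case False
    have off: "\<not> inc R (line Q A)" "\<not> inc P (line Q A)" using n triangle_offline by blast+
    then have o: "opposite_sides (line Q A) R P" using False side_cases by blast
    obtain S where S: "btw P Q S" using d exists_beyond by blast
    have "opposite_sides (line Q A) P S" using btw_opposite[OF S] off d by simp
    then have "same_side (line Q A) R S" using o opposite_opposite by blast
    moreover have "right_angle S Q A" using right_sym right_opposite r S by blast
    ultimately have "inc R (line Q S)" using same by blast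
    moreover have "line Q S = line Q P"
      using line_eq[of Q S "line Q P"] btw_inc(1)[OF S, of "line Q P"] btw_distinct[OF S]
        line_inc[of Q P] by blast
    ultimately show ?thesis by simp
  qed (use same r in blast)
qed

subsection \<open>Perpendiculars and acute angles\<close>

definition foot :: "'p \<Rightarrow> 'p \<Rightarrow> 'l \<Rightarrow> bool" where
  "foot P Q l \<longleftrightarrow> inc Q l \<and> \<not> inc P l \<and> (\<forall>A. inc A l \<longrightarrow> A \<noteq> Q \<longrightarrow> right_angle P Q A)"

lemma footI:
  assumes "right_angle P Q A" "inc Q l" "inc A l"
  shows "foot P Q l"
proof -
  have n: "\<not> collinear P Q A" using assms right_noncollinear by blast
  have d: "Q \<noteq> A" using n by auto
  have l: "line Q A = l" using line_eq d assms by blast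
  have "\<not> inc P l" using n triangle_offline l by blast
  then show ?thesis using assms right_line l unfolding foot_def by blast
qed

text \<open>The axioms provide no order on angles, so "less than a right angle" is expressed by a
  right angle on the side \<open>A B\<close> that contains the ray \<open>A C\<close>.\<close>

definition acute :: "'p \<Rightarrow> 'p \<Rightarrow> 'p \<Rightarrow> bool" where
  "acute C A B \<longleftrightarrow> (\<exists>R. right_angle R A B \<and> C \<in> angle_interior R A B)"

lemma acute_noncollinear: "acute C A B \<Longrightarrow> \<not> collinear C A B"
  unfolding acute_def using right_noncollinear interior_noncollinear by blast

lemma acute_not_right:
  assumes "acute C A B" "right_angle C A B"
  shows False
proof -
  obtain R where R: "right_angle R A B" "C \<in> angle_interior R A B"
    using assms acute_def by blast
  then have "\<not> inc C (line A R)" using same_side_off unfolding angle_interior_def by blast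
  then show False using perpendicular_unique[OF R(1) assms(2)] by blast
qed

text \<open>Both right angles stand on the same perpendicular at \<open>A\<close>, so
  \<open>C\<close> would lie on the side of \<open>B\<close> and on that of \<open>B'\<close> of a
  line that separates them.\<close>

lemma acute_supplement_not_acute:
  assumes b: "btw B A B'" and a: "acute C A B" "acute C A B'"
  shows False
proof -
  obtain R where R: "right_angle R A B" "C \<in> angle_interior R A B"
    using a acute_def by blast
  obtain R' where R': "right_angle R' A B'" "C \<in> angle_interior R' A B'"
    using a acute_def by blast
  have n: "\<not> collinear R A B" "\<not> collinear R' A B'" using R R' right_noncollinear by blast+
  have d: "A \<noteq> R" "A \<noteq> R'" using n by auto
  have "right_angle R' A B" using right_opposite[OF R'(1) btw_sym[OF b]] .
  then have "inc R' (line A R)" using perpendicular_unique[OF R(1)] by blast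
  then have l: "line A R' = line A R" using line_eq d by simp
  have "same_side (line A R) C B" "same_side (line A R) C B'"
    using R R' l unfolding angle_interior_def by auto
  then have "same_side (line A R) B B'" using same_side_trans same_side_sym by blast
  moreover have "opposite_sides (line A R) B B'"
    using btw_opposite[OF b, of "line A R"] n triangle_offline d by simp
  ultimately show False using same_not_opposite by blast
qed

end

text \<open>Common interface of the two groups of principles: both are shown below to supply these
  two facts, so SAS has to be derived only once.\<close>

locale foot_plane = RCT_plane inc btw seg_cong ang_cong
  for inc :: "'p \<Rightarrow> 'l \<Rightarrow> bool"
    and btw :: "'p \<Rightarrow> 'p \<Rightarrow> 'p \<Rightarrow> bool"
    and seg_cong :: "'p set \<Rightarrow> 'p set \<Rightarrow> bool"
    and ang_cong :: "'p set set \<Rightarrow> 'p set set \<Rightarrow> bool" +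
  assumes hypotenuse_angle:
      "\<lbrakk>right_angle P Q A; right_angle P' Q' A'; segc A P A' P'; angc P A Q P' A' Q'\<rbrakk>
        \<Longrightarrow> segc A Q A' Q' \<and> segc P Q P' Q'"
    and foot_exists: "\<not> inc P l \<Longrightarrow> \<exists>Q. foot P Q l"
begin

text \<open>From a point \<open>Z\<close> of the line beyond two feet, both are seen under the same angle and
  with the same hypotenuse.\<close>

lemma foot_unique:
  assumes "foot P Q l" "foot P R l"
  shows "Q = R"
proof (rule ccontr)
  assume d: "Q \<noteq> R"
  then obtain Z where "btw R Q Z" using exists_beyond by metis
  then have Z: "btw Z Q R" by (rule btw_sym)
  have Zl: "inc Z l" "Z \<noteq> Q" "Z \<noteq> R"
    using btw_inc(3)[OF Z] btw_distinct[OF Z] assms unfolding foot_def by auto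
  have r: "right_angle P Q Z" "right_angle P R Z" using assms Zl unfolding foot_def by blast+
  have n: "\<not> collinear P Z Q"
    using right_noncollinear[OF r(1)] unfolding collinear_def by blast
  have ray: "ray Z R = ray Z Q" using btw_ray[OF Z] .
  have "angc P Z Q P Z R" using angle_rays_refl[OF n refl ray] not_collinear_distinct[OF n] Zl by auto
  moreover have "segc Z P Z P" using segc_refl[of Z P] not_collinear_distinct[OF n] by blast
  ultimately have "segc Z Q Z R" using hypotenuse_angle[OF r] by blast
  then show False using segment_copy_unique ray d by metis
qed

text \<open>The right angle found at the foot of \<open>S\<close> is copied to
  \<open>A\<close>.\<close>

lemma perpendicular_exists:
  assumes "A \<noteq> B" "\<not> inc S (line A B)"
  shows "\<exists>R. same_side (line A B) R S \<and> right_angle R A B"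
proof -
  obtain Q where Q: "foot S Q (line A B)" using foot_exists assms by blast
  obtain X where X: "X \<noteq> Q" "inc X (line A B)" using assms line_inc by metis
  then have r: "right_angle S Q X" using Q unfolding foot_def by blast
  then obtain R where R: "same_side (line A B) R S" "angc B A R S Q X"
    using angle_copy[OF _ assms, of X Q S] angc_right[of B A _ X Q S] collinear_reverse
      right_noncollinear[OF r] by blast
  have "right_angle R A B" using right_cong[OF r angc_sym[OF angc_left[OF R(2)]]] .
  then show ?thesis using R by blast
qed

text \<open>Perpendiculars to one line at distinct points do not meet, since a common point would
  have two feet. Hence the segment \<open>C Q\<close> misses the perpendicular at
  \<open>A\<close>.\<close>

lemma perpendiculars_disjoint:
  assumes r: "right_angle R A B" "right_angle C Q A" and Q: "inc Q (line A B)"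
  shows "same_side (line A R) C Q"
proof -
  have n: "\<not> collinear R A B" "\<not> collinear C Q A" using r right_noncollinear by blast+
  have d: "A \<noteq> R" "A \<noteq> B" "Q \<noteq> A" "C \<noteq> Q" "C \<noteq> A" using n by auto
  have l: "line Q A = line A B" using line_eq Q d by simp
  have off: "\<not> inc R (line A B)" "\<not> inc C (line A B)" using triangle_offline[OF n(1)] triangle_offline[OF n(2)] l by auto
  have *: False if W: "inc W (line A R)" "inc W (line Q C)" "W \<noteq> A" "W \<noteq> Q" for W
  proof -
    have "right_angle B A W" using right_line[OF right_sym[OF r(1)]] W by blast
    then have "foot W A (line A B)" using footI[OF right_sym] d by simp
    moreover have "right_angle A Q W" using right_line[OF right_sym[OF r(2)]] W by blast
    then have "foot W Q (line A B)" using footI[OF right_sym] d Q by simp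
    ultimately show False using foot_unique d by blast
  qed
  have nQ: "\<not> inc Q (line A R)"
  proof
    assume "inc Q (line A R)"
    then have "line A R = line A B"
      using line_unique[of Q A "line A R" "line A B"] Q d by simp
    then show False using off d line_inc2[of A R] by simp
  qed
  have nA: "\<not> inc A (line Q C)" using n triangle_offline by blast
  have "\<not> inc C (line A R)" using *[of C] d by auto
  moreover have "\<not> opposite_sides (line A R) C Q"
  proof
    assume "opposite_sides (line A R) C Q"
    then obtain W where W: "btw C W Q" "inc W (line A R)" using opposite_btw by blast
    have "inc W (line Q C)" using btw_inc(2)[OF W(1), of "line Q C"] d by simp
    then show False using * W nQ nA by blast
  qed
  ultimately show ?thesis using nQ side_cases by blast
qed

text \<open>The perpendicular erected at \<open>A\<close> does not separate \<open>C\<close> from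
  \<open>Q\<close>, so \<open>C\<close> lies inside the right angle there.\<close>

lemma leg_acute:
  assumes r: "right_angle C Q A"
  shows "acute C A Q"
proof -
  have n: "\<not> collinear C Q A" using r right_noncollinear by blast
  have d: "A \<noteq> Q" "\<not> inc C (line A Q)" using n triangle_offline by auto
  obtain R where R: "same_side (line A Q) R C" "right_angle R A Q"
    using perpendicular_exists[OF d] by blast
  have "same_side (line A R) C Q" using perpendiculars_disjoint[OF R(2) r] d by simp
  then show ?thesis using R same_side_sym unfolding acute_def angle_interior_def by blast
qed

text \<open>[RCT] transports the ray inside a right angle to a right angle at \<open>D\<close>;
  uniqueness of angle copying identifies its image with the ray \<open>D F\<close>.\<close>

lemma acute_cong:
  assumes a: "acute C A B" and c: "angc C A B F D E"
  shows "acute F D E"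
proof -
  obtain R where R: "right_angle R A B" "C \<in> angle_interior R A B"
    using a acute_def by blast
  have n: "\<not> collinear F D E" using c angc_noncollinear by blast
  have d: "D \<noteq> E" "\<not> inc F (line D E)" "F \<noteq> D" using n triangle_offline by auto
  obtain S where S: "same_side (line D E) S F" "right_angle S D E"
    using perpendicular_exists[OF d(1,2)] by blast
  obtain H where H: "H \<in> angle_interior S D E" "angc C A B H D E"
    using ray_copy[OF right_angles_congruent[OF R(1) S(2)] R(2)] by blast
  have "same_side (line D E) H S" using H unfolding angle_interior_def by blast
  then have "same_side (line D E) H F" using S same_side_trans by blast
  moreover have "angc E D H E D F" using angc_swap[OF angc_trans[OF angc_sym[OF H(2)] c]] .
  ultimately have "ray D H = ray D F" using angle_copy_unique by blast
  then have "F \<in> angle_interior S D E"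
    using interior_ray[OF right_noncollinear[OF S(2)] H(1)] d by blast
  then show ?thesis using S acute_def by blast
qed

text \<open>The position of the foot tells whether \<open>C A B\<close> is right, acute or obtuse:
  \<open>leg_acute\<close> makes the angle at \<open>A\<close> of the right triangle
  \<open>C Q A\<close> acute, and this angle is \<open>C A B\<close> or its supplement.\<close>

lemma foot_cases:
  assumes d: "A \<noteq> B" and f: "foot C Q (line A B)"
  shows "Q = A \<and> right_angle C A B \<or>
    Q \<noteq> A \<and> ray A Q = ray A B \<and> acute C A B \<or>
    btw Q A B \<and> acute C A Q"
proof (cases "Q = A")
  case True
  then show ?thesis using f d unfolding foot_def by simp
next
  case False
  then have "right_angle C Q A" using f d unfolding foot_def by auto
  then have a: "acute C A Q" by (rule leg_acute)
  consider "ray A Q = ray A B" | "btw Q A B"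
    using line_cases[of A B Q] d f False unfolding foot_def by blast
  then show ?thesis
  proof cases
    case 1
    have "angc C A Q C A B"
      using angle_rays_refl[OF acute_noncollinear[OF a] refl, of B] 1 d
        not_collinear_distinct[OF acute_noncollinear[OF a]] by auto
    then show ?thesis using 1 False acute_cong a by blast
  qed (use a in blast)
qed

text \<open>The cases of \<open>foot_cases\<close> exclude one another, and being right or acute is
  invariant under congruence, so the feet fall in corresponding positions.\<close>

lemma foot_transfer:
  assumes c: "angc C A B F D E" and f: "foot C Q (line A B)" "foot F Q' (line D E)"
  shows "Q = A \<and> Q' = D \<and> right_angle C A B \<or>
    Q \<noteq> A \<and> Q' \<noteq> D \<and> ray A Q = ray A B \<and> ray D Q' = ray D E \<or>
    btw Q A B \<and> btw Q' D E"
proof -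
  have n: "\<not> collinear C A B" "\<not> collinear F D E" using c angc_noncollinear by blast+
  have d: "A \<noteq> B" "D \<noteq> E" using n by auto
  have obtuse: "\<not> right_angle X Y Z \<and> \<not> acute X Y Z"
    if "btw W Y Z" "acute X Y W" for W X Y Z
    using that acute_supplement_not_acute acute_not_right right_opposite btw_sym by blast
  have "right_angle C A B \<longleftrightarrow> right_angle F D E" using right_cong c angc_sym by blast
  moreover have "acute C A B \<longleftrightarrow> acute F D E" using acute_cong c angc_sym by blast
  ultimately show ?thesis
    using foot_cases[OF d(1) f(1)] foot_cases[OF d(2) f(2)] obtuse[of Q A B C] obtuse[of Q' D E F]
      acute_not_right[of C A B] by blast
qed

text \<open>Copy the angle at \<open>E\<close> and the hypotenuse \<open>E F\<close> onto
  \<open>B A\<close>, giving \<open>X\<close>. By hypotenuse-angle congruence the foot of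
  \<open>X\<close> is \<open>A\<close>; the perpendicular at \<open>A\<close> and the length of the
  leg then force \<open>X = C\<close>.\<close>

lemma right_SAS:
  assumes r: "right_angle C A B" "right_angle F D E"
    and s: "segc A B D E" "segc A C D F"
  shows "segc B C E F \<and> angc A B C D E F"
proof -
  have n: "\<not> collinear C A B" "\<not> collinear F D E" using r right_noncollinear by blast+
  have n': "\<not> collinear D E F" using n collinear_rot by blast
  have d: "A \<noteq> B" "D \<noteq> E" "E \<noteq> F" "B \<noteq> C" "A \<noteq> C" using n by auto
  have off: "\<not> inc C (line B A)" using n triangle_offline by blast
  obtain X where X: "same_side (line B A) X C" "angc A B X D E F" "segc B X E F"
    using triangle_copy[OF n' _ off d(3)] d by blast
  have offX: "\<not> inc X (line B A)" using X same_side_off by blast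
  then obtain Q where Q: "foot X Q (line B A)" using foot_exists by blast
  \<comment> \<open>The foot of \<open>F\<close> is \<open>D\<close>, so
    \<open>foot_transfer\<close> puts \<open>Q\<close> on the ray \<open>B A\<close>: the other
    cases would require \<open>D = E\<close> or \<open>btw D E D\<close>.\<close>
  have "foot F D (line E D)" using footI[OF r(2)] d by simp
  then have QB: "Q \<noteq> B" "ray B Q = ray B A"
    using foot_transfer[OF angc_swap[OF X(2)] Q] d ray_not_opposite[of E D D] btw_distinct
    by blast+
  have rX: "right_angle X Q B" using Q QB d unfolding foot_def by simp
  have "X \<noteq> B" using offX d by auto
  then have "angc X B Q F E D" using angc_rays[OF angc_swap[OF X(2)] refl QB(2)] QB by blast
  then have h: "segc B Q E D" "segc X Q F D" using hypotenuse_angle[OF rX r(2) X(3)] by blast+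
  have "segc B Q B A" using segc_trans[OF h(1) segc_swap[OF segc_sym[OF s(1)]]] .
  then have QA: "Q = A" using segment_copy_unique QB by blast
  have rA: "right_angle X A B" using rX QA by simp
  have "angc B A X B A C" using angc_swap[OF right_angles_congruent[OF rA r(1)]] .
  moreover have "same_side (line A B) X C" using X line_commute by metis
  ultimately have "ray A X = ray A C" using angle_copy_unique by blast
  moreover have "segc A X A C" using segc_trans[OF segc_swap[OF h(2)] segc_sym[OF s(2)]] QA by simp
  ultimately have "X = C" using segment_copy_unique by blast
  then show ?thesis using X by blast
qed

text \<open>Perpendiculars from \<open>C\<close> and \<open>F\<close> reduce the claim to right
  triangles. \<open>foot_transfer\<close> aligns the feet; those at \<open>A\<close> and
  \<open>D\<close> are matched by \<open>hypotenuse_angle\<close>, then those at \<open>B\<close>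
  and \<open>E\<close> by \<open>right_SAS\<close>. The remaining angle follows later by exchanging
  \<open>B\<close> and \<open>C\<close>.\<close>

lemma SAS_side_angle:
  assumes c: "angc B A C E D F" and s: "segc A B D E" "segc A C D F"
  shows "segc B C E F \<and> angc A B C D E F"
proof -
  have n: "\<not> collinear B A C" "\<not> collinear E D F" using c angc_noncollinear by blast+
  have d: "A \<noteq> B" "D \<noteq> E" "C \<noteq> A" "F \<noteq> D" "B \<noteq> C" "E \<noteq> F" using n by auto
  have off: "\<not> inc C (line A B)" "\<not> inc F (line D E)" using n triangle_offline by blast+
  have nB: "\<not> collinear A B C" "\<not> collinear D E F" using off offline_triangle d by blast+
  obtain Q where Q: "foot C Q (line A B)" using foot_exists off by blast
  obtain Q' where Q': "foot F Q' (line D E)" using foot_exists off by blast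
  have r: "Y \<noteq> Q \<Longrightarrow> inc Y (line A B) \<Longrightarrow> right_angle C Q Y"
    "Z \<noteq> Q' \<Longrightarrow> inc Z (line D E) \<Longrightarrow> right_angle F Q' Z" for Y Z
    using Q Q' unfolding foot_def by blast+
  have ha: "segc A Q D Q' \<and> segc C Q F Q'" if "angc C A Q F D Q'"
  proof -
    have "Q \<noteq> A" "Q' \<noteq> D" using angc_noncollinear[OF that] by auto
    then show ?thesis using hypotenuse_angle[of C Q A F Q' D] r d s that by simp
  qed
  have base: "segc B C E F \<and> angc Q B C Q' E F"
    if "Q \<noteq> B" "Q' \<noteq> E" "segc C Q F Q'" "segc Q B Q' E"
    using right_SAS[of C Q B F Q' E] r that d segc_swap by simp
  consider "Q = A" "Q' = D" "right_angle C A B"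
    | "Q \<noteq> A" "Q' \<noteq> D" "ray A Q = ray A B" "ray D Q' = ray D E"
    | "btw Q A B" "btw Q' D E"
    using foot_transfer[OF angc_swap[OF c] Q Q'] by blast
  then show ?thesis
  proof cases
    case 1
    then show ?thesis using right_SAS[of C A B F D E] r d s by simp
  next
    case 2
    have "angc C A Q F D E" using angc_rays[OF angc_swap[OF c] refl 2(3)] d 2 by blast
    then have "angc C A Q F D Q'"
      using angc_sym[OF angc_rays[OF angc_sym refl 2(4)]] d 2 by blast
    then have h: "segc A Q D Q'" "segc C Q F Q'" using ha by blast+
    \<comment> \<open>In these cases the angle of the triangle at \<open>B\<close> is right, equal
      to \<open>Q B C\<close>, or the supplement of \<open>Q B C\<close>.\<close>
    consider "Q = B" | "btw A Q B" | "btw A B Q"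
    proof -
      have "Q \<in> ray A B" using 2(3) ray_end by blast
      then show ?thesis using that 2(1) unfolding ray_def by blast
    qed
    then show ?thesis
    proof cases
      case 1
      have "segc D Q' D E" using segc_trans[OF segc_sym[OF h(1)]] s 1 by simp
      then have "Q' = E" using segment_copy_unique 2 by blast
      then have "angc C B A F E D" using right_angles_congruent r d 1 by simp
      then show ?thesis using h 1 \<open>Q' = E\<close> angc_swap segc_swap by blast
    next
      case b: 2
      have b': "btw D Q' E" "segc Q B Q' E"
        using segment_subtract[OF b h(1) s(1) 2(4)] by blast+
      have "segc B C E F \<and> angc Q B C Q' E F"
        using base b b' btw_distinct h by blast
      moreover have "ray B A = ray B Q" "ray E D = ray E Q'"
        using btw_ray[OF btw_sym[OF b]] btw_ray[OF btw_sym[OF b'(1)]] by auto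
      ultimately have "segc B C E F" "angc A B C Q' E F" "ray E D = ray E Q'"
        using angc_rays[of Q B C Q' E F A C] d by auto
      then show ?thesis using angc_sym[OF angc_rays[OF angc_sym _ refl]] d by metis
    next
      case b: 3
      have b': "btw D E Q'" "segc B Q E Q'"
        using segment_subtract[OF b s(1) h(1)] 2(4) by auto
      then have "segc B C E F \<and> angc Q B C Q' E F"
        using base b btw_distinct h segc_swap by blast
      then show ?thesis
        using supplements_congruent[OF btw_sym[OF b] btw_sym[OF b'(1)]] by blast
    qed
  next
    case 3
    \<comment> \<open>The angle at \<open>A\<close> is obtuse here: the right triangle contains its
      supplement, and \<open>Q B\<close> is the sum of \<open>Q A\<close> and
      \<open>A B\<close>.\<close>
    have "angc Q A C Q' D F" using supplements_congruent[OF btw_sym[OF 3(1)] btw_sym[OF 3(2)] c] .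
    then have h: "segc A Q D Q'" "segc C Q F Q'" using ha angc_swap by blast+
    have "segc Q B Q' E" using segment_add[OF 3 segc_swap[OF h(1)] s(1)] .
    then have k: "segc B C E F \<and> angc Q B C Q' E F"
      using base 3 btw_distinct h by blast
    have ry: "ray B A = ray B Q" "ray E D = ray E Q'"
      using btw_ray[OF btw_sym[OF 3(1)]] btw_ray[OF btw_sym[OF 3(2)]] by auto
    have "angc A B C Q' E F" using angc_rays[of Q B C Q' E F A C] k ry d by auto
    then have "angc A B C D E F"
      using angc_sym[OF angc_rays[OF angc_sym ry(2) refl]] d by metis
    then show ?thesis using k by blast
  qed
qed

theorem SAS_holds: SAS
  unfolding SAS_def
proof (intro allI impI, elim conjE)
  fix A B C D E F
  assume t: "triangle A B C" "triangle D E F"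
    and h: "seg_cong (segment A B) (segment D E)" "ang_cong (angle B A C) (angle E D F)"
      "seg_cong (segment A C) (segment D F)"
  have n: "\<not> collinear A B C" "\<not> collinear D E F" using t unfolding triangle_def by blast+
  then have n': "\<not> collinear B A C" "\<not> collinear E D F" using collinear_swap by blast+
  have d: "A \<noteq> B" "A \<noteq> C" "D \<noteq> E" "D \<noteq> F" using n by auto
  have s: "segc A B D E" "segc A C D F" using h d unfolding segc_def by blast+
  have a: "angc B A C E D F" using h n' unfolding angc_def by blast
  have "segc B C E F" "angc A B C D E F" using SAS_side_angle[OF a s] by blast+
  moreover have "angc A C B D F E" using SAS_side_angle[OF angc_swap[OF a] s(2,1)] by blast
  ultimately show "triangle_cong A B C D E F"
    using t h unfolding triangle_cong_def segc_def angc_def by blast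
qed

end

subsection \<open>Existence of feet\<close>

context RCT_plane
begin

text \<open>The kite property is a hypothesis because the two groups prove it differently. It makes
  the adjacent angles congruent at the point \<open>R\<close> where \<open>l\<close> crosses the
  segment from \<open>P\<close> to its mirror image \<open>P'\<close>, so \<open>R\<close> is the
  foot.\<close>

lemma foot_from_kites:
  assumes kite: "\<And>Z P P' R. \<lbrakk>btw P R P'; segc Z P Z P'; angc P Z R P' Z R\<rbrakk>
      \<Longrightarrow> angc P R Z P' R Z"
    and P: "\<not> inc P l"
  shows "\<exists>Q. foot P Q l"
proof -
  obtain Z Y where ZY: "Z \<noteq> Y" "inc Z l" "inc Y l" using I2[of l] by blast
  have l: "line Z Y = l" using line_eq ZY by blast
  have d: "P \<noteq> Z" using P ZY by auto
  have n: "\<not> collinear Y Z P" using P l ZY collinear_iff[of Z Y P] collinear_swap[of Z Y P] by simp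
  obtain S where S: "btw P Z S" using d exists_beyond by blast
  have o: "opposite_sides l P S" using btw_opposite[OF S ZY(2) P] .
  obtain P' where P': "same_side l P' S" "angc Y Z P' Y Z P" "segc Z P' Z P"
    using triangle_copy[OF n ZY(1) _ d[symmetric], of S] o opposite_sides_off l by auto
  have "opposite_sides l P P'" using o P' same_opposite opposite_sides_sym by blast
  then obtain R where R: "btw P R P'" "inc R l" using opposite_btw by blast
  show ?thesis
  proof (cases "R = Z")
    case True
    \<comment> \<open>If the crossing point is \<open>Z\<close> itself, the congruent angles
      \<open>Y Z P\<close> and \<open>Y Z P'\<close> are already supplements of each other.\<close>
    then have "right_angle Y Z P" using R P'(2) angc_sym unfolding right_angle_def by blast
    then show ?thesis using footI[OF right_sym] ZY by blast
  next
    case False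
    have "angc R Z P' R Z P"
    proof -
      \<comment> \<open>\<open>R\<close> may lie beyond \<open>Z\<close> as seen from
        \<open>Y\<close>; the angles of the kite at \<open>Z\<close> are then supplements of the
        copied ones.\<close>
      consider "ray Z R = ray Z Y" | "btw Y Z R"
        using line_cases[of Z Y R] ZY False R l btw_sym[of R Z Y] by blast
      then show ?thesis
      proof cases
        case 1
        have "angc R Z P' Y Z P"
          using angc_rays[OF P'(2) 1 refl False] P'(3) unfolding segc_def by blast
        then show ?thesis using angc_sym[OF angc_rays[OF angc_sym 1 refl False d]] by blast
      qed (use supplements_congruent P'(2) in blast)
    qed
    then have "angc P Z R P' Z R" using angc_sym[OF angc_swap] by blast
    then have "angc P R Z P' R Z" using kite[OF R(1) segc_sym[OF P'(3)]] by blast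
    then have "right_angle Z R P" using R(1) angc_swap unfolding right_angle_def by blast
    then show ?thesis using footI[OF right_sym] ZY R by blast
  qed
qed

section \<open>Uniqueness of angle bisectors\<close>

lemma btw_interior:
  assumes "\<not> collinear P Z M" "btw P R M"
  shows "R \<in> angle_interior P Z M"
proof -
  have d: "P \<noteq> Z" "M \<noteq> Z" using assms by auto
  have off: "\<not> inc M (line Z P)" "\<not> inc P (line Z M)" using assms triangle_offline by blast+
  have "\<not> inc R (line Z P)" "\<not> inc R (line Z M)"
    using btw_inc(1)[OF assms(2), of "line Z P"] btw_inc(3)[OF assms(2), of "line Z M"] off d
    by auto
  then show ?thesis
    using btw_same[OF assms(2), of "line Z P"] btw_same[OF btw_sym[OF assms(2)], of "line Z M"] d
    unfolding angle_interior_def by simp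
qed

text \<open>[RCT] carries the ray \<open>Z R\<close> from \<open>P Z M\<close> into
  \<open>P' Z M\<close> as \<open>Z H\<close>. As \<open>P' Z H\<close> and \<open>P' Z R\<close>
  are congruent, \<open>Z H\<close> is the ray \<open>Z R\<close> itself, which would lie on both
  sides of \<open>Z M\<close>.\<close>

lemma bisector_not_less:
  assumes b: "btw P R P'" "btw P M P'" "btw P R M"
    and a: "angc P Z R P' Z R" "angc P Z M P' Z M"
  shows False
proof -
  have nM: "\<not> collinear P Z M" "\<not> collinear P' Z M" using a angc_noncollinear by blast+
  have d: "P' \<noteq> Z" "M \<noteq> Z" "R \<noteq> Z" using nM a angc_noncollinear[OF a(1)] by auto
  have R: "R \<in> angle_interior P Z M" using btw_interior[OF nM(1) b(3)] .
  obtain H where H: "H \<in> angle_interior P' Z M" "angc P Z R P' Z H"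
    using ray_copy[OF a(2) R] by blast
  have "angc P' Z H P' Z R" using angc_trans[OF angc_sym[OF H(2)] a(1)] .
  moreover have "same_side (line Z P') H R"
  proof -
    have off: "\<not> inc M (line Z P')" "\<not> inc R (line Z P')"
      using nM angc_noncollinear[OF a(1)] triangle_offline by blast+
    have "same_side (line Z P') M P" "same_side (line Z P') R P"
      using btw_same[OF btw_sym[OF b(2)], of "line Z P'"]
        btw_same[OF btw_sym[OF b(1)], of "line Z P'"] off d by simp_all
    moreover have "same_side (line Z P') H M" using H unfolding angle_interior_def by blast
    ultimately show ?thesis using same_side_trans[OF _ same_side_sym] same_side_trans by blast
  qed
  ultimately have "ray Z H = ray Z R" using angle_copy_unique by blast
  then have "H \<in> ray Z R" using ray_end by blast
  have s: "same_side (line Z M) H P'" "same_side (line Z M) R P"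
    using H R unfolding angle_interior_def by blast+
  have "H \<noteq> Z" using same_side_off[OF s(1)] d by auto
  then have "same_side (line Z M) H R"
    using ray_same_side[of H Z R "line Z M"] \<open>H \<in> ray Z R\<close> same_side_off[OF s(2)] d by simp
  then have "same_side (line Z M) P P'"
    using s same_side_trans same_side_sym by blast
  moreover have "opposite_sides (line Z M) P P'"
    using btw_opposite[OF b(2), of "line Z M"] d triangle_offline[OF nM(1)] by simp
  ultimately show False using same_not_opposite by blast
qed

text \<open>\<open>bisector_not_less\<close> excludes the two orders with \<open>P\<close> at an
  end; \<open>P\<close> cannot be in the middle because \<open>R\<close> and \<open>M\<close> both
  lie on the ray \<open>P P'\<close>.\<close>

lemma bisector_unique:
  assumes b: "btw P R P'" "btw P M P'"
    and a: "angc P Z R P' Z R" "angc P Z M P' Z M"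
  shows "R = M"
proof (rule ccontr)
  assume d: "R \<noteq> M"
  obtain l where "inc P l" "inc R l" "inc P' l" using b btw_line by blast
  moreover from this have "inc M l" using b btw_inc by blast
  ultimately consider "btw R P M" | "btw P R M" | "btw P M R"
    using btw_cases[of P R M l] d btw_distinct b by blast
  then show False
  proof cases
    case 1
    have "ray P R = ray P M" using btw_ray b by metis
    then show False using ray_not_opposite 1 btw_distinct by blast
  qed (use bisector_not_less a b in blast)+
qed

section \<open>The kite property and hypotenuse-angle congruence from either group\<close>

lemma kite_noncollinear:
  assumes "btw P R P'" "angc P Z R P' Z R"
  shows "\<not> collinear P Z P'"
  using assms angc_noncollinear btw_inc unfolding collinear_def by blast

text \<open>SSS makes the halves at the midpoint \<open>M\<close> congruent, so \<open>Z M\<close>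
  bisects the angle at \<open>Z\<close>. By \<open>bisector_unique\<close> \<open>M\<close> is
  \<open>R\<close>, and SSS also gives the angles there.\<close>

lemma kite_SSS:
  assumes sss: SSS and ms: MS
    and b: "btw P R P'" and s: "segc Z P Z P'" and a: "angc P Z R P' Z R"
  shows "angc P R Z P' R Z"
proof -
  have n: "\<not> collinear P Z P'" using kite_noncollinear[OF b a] .
  have d: "P \<noteq> P'" using n by auto
  then obtain M where M: "btw P M P'" "seg_cong (segment P M) (segment M P')"
    using ms unfolding MS_def by blast
  have nM: "\<not> collinear Z P M" "\<not> collinear Z P' M"
    using n M(1) btw_inc btw_distinct unfolding collinear_def by blast+
  have "Z \<noteq> M" using nM by auto
  then have "triangle_cong Z P M Z P' M"
    using sss M(2) nM s C2_refl unfolding SSS_def triangle_def segc_def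
    by (simp add: segment_commute)
  then have "angc P Z M P' Z M" "angc Z M P Z M P'"
    using nM collinear_swap collinear_rot unfolding triangle_cong_def angc_def by blast+
  moreover from this have "R = M" using bisector_unique b M(1) a by blast
  ultimately show ?thesis using angc_swap by blast
qed

text \<open>[PA] gives congruent base angles at \<open>P\<close> and \<open>P'\<close>; SAA then
  applies to \<open>Z P R\<close> and \<open>Z P' R\<close> with common side
  \<open>Z R\<close>.\<close>

lemma kite_SAA:
  assumes saa: SAA and pa: PA
    and b: "btw P R P'" and s: "segc Z P Z P'" and a: "angc P Z R P' Z R"
  shows "angc P R Z P' R Z"
proof -
  have n: "\<not> collinear P Z P'" using kite_noncollinear[OF b a] .
  have nR: "\<not> collinear P Z R" "\<not> collinear P' Z R" using a angc_noncollinear by blast+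
  have c: "angc Z P P' Z P' P"
    using pa n s unfolding PA_def triangle_def segc_def angc_def
    using collinear_swap collinear_rot by blast
  have ray: "ray P R = ray P P'" "ray P' R = ray P' P"
    using btw_ray[OF b] btw_ray[OF btw_sym[OF b]] by auto
  have d: "Z \<noteq> P" "R \<noteq> P" "Z \<noteq> P'" "R \<noteq> P'" using nR by auto
  have "angc Z P R Z P' P" using angc_rays[OF c refl ray(1) d(1,2)] .
  then have "angc Z P R Z P' R" using angc_sym[OF angc_rays[OF angc_sym refl ray(2) d(3,4)]] by blast
  then have "triangle_cong Z P R Z P' R"
    using saa[unfolded SAA_def, rule_format, of Z P R Z P' R] a C2_refl[of Z R]
      not_collinear_distinct[OF nR(1)] collinear_swap[of Z P R] collinear_swap[of Z P' R] nR
    unfolding triangle_def angc_def by blast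
  then have "angc Z R P Z R P'"
    using nR collinear_swap collinear_rot unfolding triangle_cong_def angc_def by blast
  then show ?thesis using angc_swap by blast
qed

lemma hypotenuse_angle_HA:
  assumes ha: HA and r: "right_angle P Q A" "right_angle P' Q' A'"
    and s: "segc A P A' P'" and a: "angc P A Q P' A' Q'"
  shows "segc A Q A' Q' \<and> segc P Q P' Q'"
proof -
  obtain X where X: "btw A Q X" "angc P Q A P Q X" using r right_angle_def by blast
  obtain X' where X': "btw A' Q' X'" "angc P' Q' A' P' Q' X'" using r right_angle_def by blast
  have n: "\<not> collinear A P Q" "\<not> collinear A' P' Q'"
    using a angc_noncollinear collinear_swap by blast+
  then have "triangle_cong A P Q A' P' Q'"
    using ha[unfolded HA_def, rule_format, of A P Q A' P' Q' X X'] X X' s a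
    unfolding triangle_def angc_def segc_def by blast
  then show ?thesis
    using not_collinear_distinct[OF n(1)] not_collinear_distinct[OF n(2)]
    unfolding triangle_cong_def segc_def by blast
qed

text \<open>Since all right angles are congruent, this is an instance of SAA with the right angle
  opposite the given side.\<close>

lemma hypotenuse_angle_SAA:
  assumes saa: SAA and r: "right_angle P Q A" "right_angle P' Q' A'"
    and s: "segc A P A' P'" and a: "angc P A Q P' A' Q'"
  shows "segc A Q A' Q' \<and> segc P Q P' Q'"
proof -
  have q: "angc A Q P A' Q' P'" using angc_swap[OF right_angles_congruent[OF r]] .
  have n: "\<not> collinear A Q P" "\<not> collinear A' Q' P'" using q angc_noncollinear by blast+
  then have "triangle_cong A Q P A' Q' P'"
    using saa[unfolded SAA_def, rule_format, of A Q P A' Q' P'] s q angc_swap[OF a]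
    unfolding triangle_def angc_def segc_def by blast
  then show ?thesis
    using not_collinear_distinct[OF n(1)] not_collinear_distinct[OF n(2)]
    unfolding triangle_cong_def segc_def by (auto simp: segment_commute)
qed

section \<open>SAS from each group\<close>

theorem SAS_from_SSS_HA:
  assumes SSS MS HA
  shows SAS
proof -
  interpret foot_plane inc btw seg_cong ang_cong
    by unfold_locales
      (use assms hypotenuse_angle_HA foot_from_kites kite_SSS in blast)+
  show ?thesis by (rule SAS_holds)
qed

theorem SAS_from_SAA_PA:
  assumes SAA PA
  shows SAS
proof -
  interpret foot_plane inc btw seg_cong ang_cong
    by unfold_locales
      (use assms hypotenuse_angle_SAA foot_from_kites kite_SAA in blast)+
  show ?thesis by (rule SAS_holds)
qed

end

theorem theorem3p11:
  fixes inc :: "'p \<Rightarrow> 'l \<Rightarrow> bool"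
    and btw :: "'p \<Rightarrow> 'p \<Rightarrow> 'p \<Rightarrow> bool"
    and seg_cong :: "'p set \<Rightarrow> 'p set \<Rightarrow> bool"
    and ang_cong :: "'p set set \<Rightarrow> 'p set set \<Rightarrow> bool"
  assumes "M_minus_plane inc btw seg_cong ang_cong"
    and "(plane_signature.SSS inc btw seg_cong ang_cong \<and>
          plane_signature.RCT inc btw ang_cong \<and>
          plane_signature.MS btw seg_cong \<and>
          plane_signature.HA inc btw seg_cong ang_cong) \<or>
         (plane_signature.SAA inc btw seg_cong ang_cong \<and>
          plane_signature.RCT inc btw ang_cong \<and>
          plane_signature.AB inc btw ang_cong \<and>
          plane_signature.SA btw ang_cong \<and>
          plane_signature.PA inc btw seg_cong ang_cong)"
  shows "plane_signature.SAS inc btw seg_cong ang_cong"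
proof -
  interpret M_minus_plane inc btw seg_cong ang_cong by fact
  have RCT using assms(2) by blast
  then interpret RCT_plane inc btw seg_cong ang_cong by unfold_locales
  show ?thesis using assms(2) SAS_from_SSS_HA SAS_from_SAA_PA by blast
qed

end
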